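(* Let $\Omega\subset\mathbb{R}^2$ be a bounded, simply connected open set containing the origin $O$ and let $\boldsymbol{E}\in\mathcal{A}(\Omega,\mathrm{Sym})$ be a singular strain field. The compatibility condition $\operatorname{Curl}\operatorname{Curl}\boldsymbol{E}=0$ (in the sense of distributions on $\Omega$) is equivalent to the following conditions together: (i) $\operatorname{curl}\operatorname{curl}(\boldsymbol{E}|_{\Omega-O})=0$ on $\Omega-O$; (ii) $\boldsymbol{E}(\mathbb{A}\nabla^2w^\alpha)=0$ for all multi-indices $\alpha\in\mathbb{N}^2$ with $|\alpha|\le\deg(\boldsymbol{E})+2$. Here, for each multi-index $\alpha$, $w^\alpha\in\mathcal{D}(\Omega)$ is a compactly supported smooth function such that for every multi-index $\beta$, $\partial^\beta w^\alpha(O)=(-1)^{|\alpha|}$ if $\beta=\alpha$ and $\partial^\beta w^\alpha(O)=0$ if $\beta\ne\alpha$.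
   Context: $\Omega-O$ means $\Omega\setminus\{O\}$; $\mathrm{Sym}$ is the space of symmetric linear maps $\mathbb{R}^2\to\mathbb{R}^2$; $\mathbb{N}$ includes $0$. $\mathcal{A}(\Omega,\mathrm{Sym})$ is the set of $\mathrm{Sym}$-valued distributions on $\Omega$ (acting by $\boldsymbol{T}(\boldsymbol{\phi})=T_{ij}(\phi_{ij})$, summation convention) whose singular support is contained in $\{O\}$; their restriction to $\Omega-O$ is given by a smooth function and is identified with it. For a vector distribution, $\operatorname{Curl}\boldsymbol{v}=\partial_1v_2-\partial_2v_1$ (a scalar); for a tensor distribution, $(\operatorname{Curl}\boldsymbol{V})_i=\partial_1V_{i2}-\partial_2V_{i1}$. Thus $\operatorname{Curl}\operatorname{Curl}\boldsymbol{E}=\partial_1\partial_1E_{22}-2\partial_1\partial_2E_{12}+\partial_2\partial_2E_{11}$. $\operatorname{curl}$ denotes the same operators applied classically to smooth functions. $\mathbb{A}$ is the linear map on $2\times2$ tensors defined by $\mathbb{A}(\boldsymbol{v}\otimes\boldsymbol{w})=(\boldsymbol{e}_3\times\boldsymbol{v})\otimes(\boldsymbol{e}_3\times\boldsymbol{w})$, where $\boldsymbol{e}_3\times\boldsymbol{v}=-v_2\boldsymbol{e}_1+v_1\boldsymbol{e}_2$; $\nabla^2w$ is the Hessian of $w$. Thus $\mathbb{A}\nabla^2w$ has components $(\mathbb{A}\nabla^2w)_{11}=\partial_2\partial_2w$, $(\mathbb{A}\nabla^2w)_{22}=\partial_1\partial_1w$, $(\mathbb{A}\nabla^2w)_{12}=(\mathbb{A}\nabla^2w)_{21}=-\partial_1\partial_2w$.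 Degree of divergence (with respect to $O$): choose an open ball $B_r\subset\Omega$ centred at $O$. For a test function $\phi$ on $B_r$ and $0<\lambda<1$ put $\phi_\lambda(\boldsymbol{x})=\lambda^{-2}\phi(\boldsymbol{x}/\lambda)$ and $(T|_{B_r})_\lambda(\phi)=T(\phi_\lambda)$. The scaling degree is $\operatorname{sd}(T)=\inf\{k\in\mathbb{R}:\lim_{\lambda\to0}\lambda^k(T|_{B_r})_\lambda=0 \text{ in the sense of distributions}\}$ and $\deg(T)=\operatorname{sd}(T)-2$ (with value $-\infty$ if the infimum is over all of $\mathbb{R}$). For tensor valued distributions the same definition is used with tensor valued test functions (equivalently, the maximum over components). *)

theory Defs
  imports "HOL-Analysis.Analysis"
begin

section \<open>Smooth functions and test functions on the plane\<close>

definition partial :: "2 \<Rightarrow> (real^2 \<Rightarrow> 'b::real_normed_vector) \<Rightarrow> real^2 \<Rightarrow> 'b" where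
  "partial i f x = frechet_derivative f (at x) (axis i 1)"

fun Ck_on :: "nat \<Rightarrow> (real^2) set \<Rightarrow> (real^2 \<Rightarrow> 'b::real_normed_vector) \<Rightarrow> bool" where
  "Ck_on 0 U f \<longleftrightarrow> continuous_on U f"
| "Ck_on (Suc k) U f \<longleftrightarrow> (\<forall>x\<in>U. f differentiable (at x)) \<and> (\<forall>i. Ck_on k U (partial i f))"

text \<open>Meant for open \<open>U\<close> only; the values of \<open>f\<close> outside \<open>U\<close> are irrelevant.\<close>

definition smooth_on :: "(real^2) set \<Rightarrow> (real^2 \<Rightarrow> 'b::real_normed_vector) \<Rightarrow> bool" where
  "smooth_on U f \<longleftrightarrow> (\<forall>k. Ck_on k U f)"

type_synonym multi_index = "nat \<times> nat"

definition mlen :: "multi_index \<Rightarrow> nat" where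
  "mlen \<alpha> = fst \<alpha> + snd \<alpha>"

definition mpartial :: "multi_index \<Rightarrow> (real^2 \<Rightarrow> 'b::real_normed_vector) \<Rightarrow> real^2 \<Rightarrow> 'b" where
  "mpartial \<alpha> f = (partial 1 ^^ fst \<alpha>) ((partial 2 ^^ snd \<alpha>) f)"

definition tsupp :: "(real^2 \<Rightarrow> 'b::real_normed_vector) \<Rightarrow> (real^2) set" where
  "tsupp \<phi> = closure (support_on UNIV \<phi>)"

text \<open>Test functions on an open set \<open>U\<close> are functions on the whole plane, extended by zero.\<close>

definition test_functions :: "(real^2) set \<Rightarrow> (real^2 \<Rightarrow> 'b::real_normed_vector) set" where
  "test_functions U = {\<phi>. smooth_on UNIV \<phi> \<and> compact (tsupp \<phi>) \<and> tsupp \<phi> \<subseteq> U}"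


section \<open>Distributions\<close>

text \<open>
  A distribution on \<open>U\<close> with values in \<open>'b\<close> (\<open>real\<close>, \<open>real^2\<close>, \<open>real^2^2\<close> for scalar, vector and
  tensor distributions) is a continuous linear map from the scalar test functions on \<open>U\<close> to \<open>'b\<close>;
  the entries \<open>T\<^sub>i\<^sub>j\<close> of a tensor distribution are \<open>\<lambda>\<phi>. T \<phi> $ i $ j\<close>.  The values of the underlying
  HOL function outside \<open>test_functions U\<close> are irrelevant, so restriction to a smaller open set is
  not written.
\<close>

type_synonym 'b distr = "(real^2 \<Rightarrow> real) \<Rightarrow> 'b"

definition distribution_on :: "(real^2) set \<Rightarrow> 'b::real_normed_vector distr \<Rightarrow> bool" where
  "distribution_on U T \<longleftrightarrow>
     (\<forall>\<phi>\<in>test_functions U. \<forall>\<psi>\<in>test_functions U. T (\<lambda>x. \<phi> x + \<psi> x) = T \<phi> + T \<psi>) \<and>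
     (\<forall>c. \<forall>\<phi>\<in>test_functions U. T (\<lambda>x. c * \<phi> x) = c *\<^sub>R T \<phi>) \<and>
     (\<forall>K. compact K \<and> K \<subseteq> U \<longrightarrow>
        (\<exists>C::real. \<exists>N::nat. \<forall>\<phi>\<in>test_functions U. tsupp \<phi> \<subseteq> K \<longrightarrow>
           norm (T \<phi>) \<le> C * (\<Sum>\<alpha>\<in>{\<alpha>. mlen \<alpha> \<le> N}. SUP x. \<bar>mpartial \<alpha> \<phi> x\<bar>)))"

definition represents_on :: "(real^2) set \<Rightarrow> (real^2 \<Rightarrow> 'b::euclidean_space) \<Rightarrow> 'b distr \<Rightarrow> bool" where
  "represents_on U f T \<longleftrightarrow>
     smooth_on U f \<and> (\<forall>\<phi>\<in>test_functions U. T \<phi> = (LINT x|lborel. \<phi> x *\<^sub>R f x))"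

definition sing_supp :: "(real^2) set \<Rightarrow> 'b::euclidean_space distr \<Rightarrow> (real^2) set" where
  "sing_supp U T = {x\<in>U. \<not> (\<exists>V f. open V \<and> x \<in> V \<and> V \<subseteq> U \<and> represents_on V f T)}"

text \<open>
  The smooth function with which the restriction of \<open>T\<close> to \<open>U\<close> is identified.  It is determined
  on \<open>U\<close> only, and only meaningful if the restriction of \<open>T\<close> to \<open>U\<close> is smooth.
\<close>

definition smooth_density :: "(real^2) set \<Rightarrow> 'b::euclidean_space distr \<Rightarrow> real^2 \<Rightarrow> 'b" where
  "smooth_density U T = (SOME f. represents_on U f T)"

definition Sym :: "(real^2^2) set" where
  "Sym = {M. transpose M = M}"

text \<open>The space \<open>\<A>(U, Sym)\<close>.\<close>

definition sing_sym_fields :: "(real^2) set \<Rightarrow> (real^2^2) distr set" where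
  "sing_sym_fields U =
     {T. distribution_on U T \<and> (\<forall>\<phi>\<in>test_functions U. T \<phi> \<in> Sym) \<and> sing_supp U T \<subseteq> {0}}"

text \<open>Action of a tensor distribution on a tensor valued test function.\<close>

definition tensor_action :: "(real^2^2) distr \<Rightarrow> (real^2 \<Rightarrow> real^2^2) \<Rightarrow> real" where
  "tensor_action T \<Phi> = (\<Sum>i\<in>UNIV. \<Sum>j\<in>UNIV. T (\<lambda>x. \<Phi> x $ i $ j) $ i $ j)"


section \<open>Curl of distributions and of functions\<close>

definition distr_partial :: "2 \<Rightarrow> real distr \<Rightarrow> real distr" where
  "distr_partial i T = (\<lambda>\<phi>. - T (partial i \<phi>))"

definition Curl_vec :: "(real^2) distr \<Rightarrow> real distr" where
  "Curl_vec v = (\<lambda>\<phi>. distr_partial 1 (\<lambda>\<psi>. v \<psi> $ 2) \<phi> - distr_partial 2 (\<lambda>\<psi>. v \<psi> $ 1) \<phi>)"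

definition Curl_ten :: "(real^2^2) distr \<Rightarrow> (real^2) distr" where
  "Curl_ten V = (\<lambda>\<phi>. \<chi> i. distr_partial 1 (\<lambda>\<psi>. V \<psi> $ i $ 2) \<phi> - distr_partial 2 (\<lambda>\<psi>. V \<psi> $ i $ 1) \<phi>)"

definition curl_vec :: "(real^2 \<Rightarrow> real^2) \<Rightarrow> real^2 \<Rightarrow> real" where
  "curl_vec v = (\<lambda>x. partial 1 (\<lambda>y. v y $ 2) x - partial 2 (\<lambda>y. v y $ 1) x)"

definition curl_ten :: "(real^2 \<Rightarrow> real^2^2) \<Rightarrow> real^2 \<Rightarrow> real^2" where
  "curl_ten V = (\<lambda>x. \<chi> i. partial 1 (\<lambda>y. V y $ i $ 2) x - partial 2 (\<lambda>y. V y $ i $ 1) x)"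

lemma Curl_vec_Curl_ten:
  "Curl_vec (Curl_ten E) \<phi> =
     E (partial 1 (partial 1 \<phi>)) $ 2 $ 2 - E (partial 2 (partial 1 \<phi>)) $ 2 $ 1
     - E (partial 1 (partial 2 \<phi>)) $ 1 $ 2 + E (partial 2 (partial 2 \<phi>)) $ 1 $ 1"
  by (simp add: Curl_vec_def Curl_ten_def distr_partial_def)


section \<open>The map \<open>\<A>\<close> and the Hessian\<close>

text \<open>\<open>e3_cross v\<close> is the cross product of the third unit vector with the plane vector \<open>v\<close>.\<close>

definition e3_cross :: "real^2 \<Rightarrow> real^2" where
  "e3_cross v = - (v $ 2) *\<^sub>R axis 1 1 + (v $ 1) *\<^sub>R axis 2 1"

definition tensor :: "real^2 \<Rightarrow> real^2 \<Rightarrow> real^2^2" where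
  "tensor v w = (\<chi> i j. v $ i * w $ j)"

text \<open>
  The linear extension of \<open>tensor v w \<mapsto> tensor (e3_cross v) (e3_cross w)\<close> from the standard basis;
  see \<open>linear_A_map\<close> and \<open>A_map_tensor\<close> below.
\<close>

definition A_map :: "real^2^2 \<Rightarrow> real^2^2" where
  "A_map M = (\<Sum>i\<in>UNIV. \<Sum>j\<in>UNIV. M $ i $ j *\<^sub>R tensor (e3_cross (axis i 1)) (e3_cross (axis j 1)))"

definition hessian :: "(real^2 \<Rightarrow> real) \<Rightarrow> real^2 \<Rightarrow> real^2^2" where
  "hessian w x = (\<chi> i j. partial i (partial j w) x)"

lemma A_map_components:
  "A_map M $ 1 $ 1 = M $ 2 $ 2" "A_map M $ 2 $ 2 = M $ 1 $ 1"
  "A_map M $ 1 $ 2 = - M $ 2 $ 1" "A_map M $ 2 $ 1 = - M $ 1 $ 2"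
  by (simp_all add: A_map_def tensor_def e3_cross_def sum_2 axis_def)

lemma linear_A_map: "linear A_map"
  by (rule linearI) (simp_all add: vec_eq_iff forall_2 A_map_components)

lemma A_map_tensor: "A_map (tensor v w) = tensor (e3_cross v) (e3_cross w)"
  unfolding vec_eq_iff forall_2 A_map_components
  by (simp add: tensor_def e3_cross_def axis_def)


section \<open>Degree of divergence\<close>

definition dilate :: "real \<Rightarrow> (real^2 \<Rightarrow> 'b::real_normed_vector) \<Rightarrow> real^2 \<Rightarrow> 'b" where
  "dilate t \<phi> = (\<lambda>x. (1 / t^2) *\<^sub>R \<phi> ((1 / t) *\<^sub>R x))"

text \<open>
  Here \<open>r\<close> is the radius of the ball around the origin used in the definition.  Both values
  take \<open>- \<infinity>\<close> if the infimum is over all of \<open>\<real>\<close>.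
\<close>

definition scaling_degree :: "real \<Rightarrow> (real^2^2) distr \<Rightarrow> ereal" where
  "scaling_degree r T =
     (INF k\<in>{k::real. \<forall>\<Phi>\<in>test_functions (ball 0 r).
          ((\<lambda>t. t powr k * tensor_action T (dilate t \<Phi>)) \<longlongrightarrow> 0) (at_right 0)}. ereal k)"

definition divergence_degree :: "real \<Rightarrow> (real^2^2) distr \<Rightarrow> ereal" where
  "divergence_degree r T = scaling_degree r T - 2"

end

theory Submission
  imports Defs
begin

text \<open>
  Write \<open>S\<close> for the scalar distribution \<open>Curl Curl E\<close>.  Moving both derivatives to the test function
  and using the symmetry of \<open>E\<close> gives \<open>S \<phi> = E (\<A> \<nabla>\<^sup>2\<phi>)\<close> (\<open>Curl_Curl_eq_tensor_action\<close>), so condition (ii) says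
  that \<open>S\<close> vanishes on certain of the functions \<open>w \<alpha>\<close>, and it is necessary.  Away from the
  origin \<open>E\<close> is a smooth function, and integration by parts together with the fundamental lemma of
  the calculus of variations shows that (i) means exactly that \<open>S\<close> vanishes on the test functions
  supported in the punctured domain (\<open>Curl_Curl_vanishes_off_origin_iff\<close>).

  For the converse assume (i), so that \<open>S\<close> is supported at the origin.  A distribution with that
  property sees only a finite jet of its argument: if \<open>\<phi>\<close> vanishes at the origin up to the order \<open>N\<close> of
  \<open>S\<close> near the origin, then \<open>S \<phi>\<close> does not change when \<open>\<phi>\<close> is multiplied by a cutoff of radius \<open>e\<close>,
  while all derivatives of the product up to order \<open>N\<close> are \<open>O(e)\<close> (\<open>point_supported_vanishes\<close>).
  Subtracting the combination of the \<open>w \<alpha>\<close> with the same \<open>N\<close>-jet as \<open>\<phi>\<close> therefore gives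
  \<open>S \<phi> = (\<Sum>\<alpha>. (-1)^\<bar>\<alpha>\<bar> * \<partial>\<^sup>\<alpha>\<phi>(0) * S (w \<alpha>))\<close> with the sum over \<open>\<bar>\<alpha>\<bar> \<le> N\<close>, and only
  \<open>S (w \<alpha>) = 0\<close> is left to prove.

  For \<open>\<bar>\<alpha>\<bar> \<le> deg E + 2\<close> this is (ii).  The number \<open>deg E + 2\<close> is the scaling degree of \<open>E\<close>, so for
  \<open>\<bar>\<alpha>\<bar> > deg E + 2\<close> there is \<open>k < \<bar>\<alpha>\<bar>\<close> such that \<open>t\<^sup>k\<close> times the rescalings of \<open>E\<close> tends to 0.  Dilating
  a function whose only nonzero derivatives at the origin have order \<open>\<bar>\<alpha>\<bar>\<close> by \<open>t\<close> multiplies its jet, and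
  hence the value of \<open>S\<close>, by \<open>t\<close> to the power \<open>- \<bar>\<alpha>\<bar>\<close>; the normalisation \<open>t\<^sup>-\<^sup>2\<close> in the rescaling of test
  functions of \<open>E\<close> cancels against the two derivatives in the Hessian.  So \<open>t\<close> to the power \<open>k - \<bar>\<alpha>\<bar>\<close>,
  which is at least 1 for \<open>t < 1\<close>, times \<open>S (w \<alpha>)\<close> tends to 0, which forces \<open>S (w \<alpha>) = 0\<close>
  (\<open>scaling_annihilates_high_order\<close>).

  The preparations build the analysis that this uses: closure properties of smooth functions,
  symmetry of mixed partials, smooth cutoffs, integration by parts, and the gluing of local
  densities of a distribution to a global one, without which the density in (i) would have no meaning.
\<close>


section \<open>Smooth functions on open sets\<close>


lemma partial_eqI: "(f has_derivative f') (at x) \<Longrightarrow> partial i f x = f' (axis i 1)"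
  unfolding partial_def by (metis frechet_derivative_at)

text \<open>
  Functions that agree near a point have the same candidates for a derivative there, so that
  \<^const>\<open>frechet_derivative\<close> makes the same choice, even if there is no candidate at all.
\<close>

lemma partial_cong_open:
  assumes "open U" "x \<in> U" "\<And>y. y \<in> U \<Longrightarrow> f y = g y"
  shows "partial i f x = partial i g x"
proof -
  have "(f has_derivative f') (at x) \<longleftrightarrow> (g has_derivative f') (at x)" for f'
    using has_derivative_transform_within_open[of f f' x UNIV U g]
      has_derivative_transform_within_open[of g f' x UNIV U f] assms by auto
  then show ?thesis
    unfolding partial_def frechet_derivative_def by simp
qed

lemma partial_const [simp]: "partial i (\<lambda>x. c) = (\<lambda>x. 0)"
  by (simp add: partial_def fun_eq_iff)

lemma partial_bounded_linear:
  assumes "bounded_linear L" "f differentiable (at x)"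
  shows "partial i (\<lambda>x. L (f x)) x = L (partial i f x)"
  unfolding partial_def[of i f]
  by (rule partial_eqI, rule bounded_linear.has_derivative[OF assms(1)])
     (use assms(2) frechet_derivative_works in blast)

lemma partial_bilinear:
  assumes "bounded_bilinear pr" "f differentiable (at x)" "g differentiable (at x)"
  shows "partial i (\<lambda>x. pr (f x) (g x)) x = pr (partial i f x) (g x) + pr (f x) (partial i g x)"
proof -
  have "((\<lambda>x. pr (f x) (g x)) has_derivative
      (\<lambda>h. pr (f x) (frechet_derivative g (at x) h) + pr (frechet_derivative f (at x) h) (g x))) (at x)"
    by (rule bounded_bilinear.FDERIV[OF assms(1)]) (use assms frechet_derivative_works in blast)+
  from partial_eqI[OF this, of i] show ?thesis by (simp add: partial_def)
qed

lemma partial_add: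
  assumes "f differentiable (at x)" "g differentiable (at x)"
  shows "partial i (\<lambda>x. f x + g x) x = partial i f x + partial i g x"
proof -
  have "((\<lambda>x. f x + g x) has_derivative
      (\<lambda>h. frechet_derivative f (at x) h + frechet_derivative g (at x) h)) (at x)"
    by (rule has_derivative_add) (use assms frechet_derivative_works in blast)+
  from partial_eqI[OF this, of i] show ?thesis by (simp add: partial_def)
qed

lemma has_derivative_partials:
  fixes f :: "real^2 \<Rightarrow> 'b::real_normed_vector"
  assumes "f differentiable (at x)"
  shows "(f has_derivative (\<lambda>h. \<Sum>i\<in>UNIV. h $ i *\<^sub>R partial i f x)) (at x)"
proof -
  let ?D = "frechet_derivative f (at x)"
  have lin: "linear ?D" by (rule linear_frechet_derivative[OF assms])
  have "?D h = (\<Sum>i\<in>UNIV. h $ i *\<^sub>R partial i f x)" for h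
  proof -
    have "h = (\<Sum>i\<in>UNIV. h $ i *\<^sub>R axis i 1)"
      by (simp add: vec_eq_iff forall_2 sum_2 axis_def)
    then have "?D h = ?D (\<Sum>i\<in>UNIV. h $ i *\<^sub>R axis i 1)" by simp
    also have "\<dots> = (\<Sum>i\<in>UNIV. h $ i *\<^sub>R partial i f x)"
      by (simp add: linear_sum[OF lin] linear_scale[OF lin] partial_def)
    finally show ?thesis .
  qed
  then have "?D = (\<lambda>h. \<Sum>i\<in>UNIV. h $ i *\<^sub>R partial i f x)" by (rule ext)
  moreover have "(f has_derivative ?D) (at x)" using assms by (simp add: frechet_derivative_works)
  ultimately show ?thesis by simp
qed

lemma differentiable_bounded_linear:
  assumes "bounded_linear L" "f differentiable net"
  shows "(\<lambda>x. L (f x)) differentiable net"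
proof -
  obtain f' where "(f has_derivative f') net" using assms(2) by (auto simp: differentiable_def)
  from bounded_linear.has_derivative[OF assms(1) this] show ?thesis by (rule differentiableI)
qed

lemma differentiable_bilinear:
  assumes "bounded_bilinear pr" "f differentiable (at x)" "g differentiable (at x)"
  shows "(\<lambda>x. pr (f x) (g x)) differentiable (at x)"
proof -
  obtain f' g' where "(f has_derivative f') (at x)" "(g has_derivative g') (at x)"
    using assms(2,3) by (auto simp: differentiable_def)
  from bounded_bilinear.FDERIV[OF assms(1) this] show ?thesis by (rule differentiableI)
qed

lemma Ck_on_SucD: "Ck_on (Suc k) U f \<Longrightarrow> Ck_on k U f"
proof (induction k arbitrary: f)
  case 0
  then show ?case
    by (simp add: continuous_at_imp_continuous_on differentiable_imp_continuous_within)
next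
  case (Suc k)
  then show ?case by (metis Ck_on.simps(2))
qed

lemma Ck_on_cong:
  assumes "open U"
  shows "\<lbrakk>\<And>x. x \<in> U \<Longrightarrow> f x = g x; Ck_on k U f\<rbrakk> \<Longrightarrow> Ck_on k U g"
proof (induction k arbitrary: f g)
  case 0
  then show ?case using continuous_on_cong by (metis Ck_on.simps(1))
next
  case (Suc k)
  have "g differentiable (at x)" if xU: "x \<in> U" for x
  proof -
    obtain f' where "(f has_derivative f') (at x)"
      using Suc.prems(2) xU unfolding Ck_on.simps differentiable_def by blast
    then have "(g has_derivative f') (at x)"
      by (rule has_derivative_transform_within_open[OF _ assms xU Suc.prems(1)])
    then show ?thesis by (rule differentiableI)
  qed
  moreover have "Ck_on k U (partial i g)" for i
  proof (rule Suc.IH)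
    show "Ck_on k U (partial i f)" using Suc.prems by simp
  qed (rule partial_cong_open[OF assms _ Suc.prems(1)])
  ultimately show ?case by simp
qed

lemma Ck_on_subset: "\<lbrakk>V \<subseteq> U; Ck_on k U f\<rbrakk> \<Longrightarrow> Ck_on k V f"
  by (induction k arbitrary: f) (auto intro: continuous_on_subset)

lemma Ck_on_local:
  "\<lbrakk>\<And>x. x \<in> U \<Longrightarrow> \<exists>V. open V \<and> x \<in> V \<and> Ck_on k V f\<rbrakk> \<Longrightarrow> Ck_on k U f"
proof (induction k arbitrary: f)
  case 0
  show ?case
    unfolding Ck_on.simps
  proof (rule continuous_at_imp_continuous_on, rule ballI)
    fix x assume "x \<in> U"
    then show "isCont f x" using 0 by (metis Ck_on.simps(1) continuous_on_eq_continuous_at)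
  qed
next
  case (Suc k)
  then show ?case unfolding Ck_on.simps by (metis)
qed

lemma Ck_on_bounded_linear:
  assumes "bounded_linear L" "open U"
  shows "Ck_on k U f \<Longrightarrow> Ck_on k U (\<lambda>x. L (f x))"
proof (induction k arbitrary: f)
  case 0
  then show ?case by (simp add: bounded_linear.continuous_on[OF assms(1)])
next
  case (Suc k)
  have "(\<lambda>x. L (f x)) differentiable (at x)" if "x \<in> U" for x
    using Suc.prems that by (intro differentiable_bounded_linear[OF assms(1)]) simp
  moreover have "Ck_on k U (partial i (\<lambda>x. L (f x)))" for i
  proof (rule Ck_on_cong[OF assms(2)])
    show "Ck_on k U (\<lambda>x. L (partial i f x))" using Suc.prems by (intro Suc.IH) simp
  qed (use Suc.prems in \<open>simp add: partial_bounded_linear[OF assms(1)]\<close>)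
  ultimately show ?case by simp
qed

lemma Ck_on_add:
  assumes "open U"
  shows "Ck_on k U f \<Longrightarrow> Ck_on k U g \<Longrightarrow> Ck_on k U (\<lambda>x. f x + g x)"
proof (induction k arbitrary: f g)
  case 0
  then show ?case by (simp add: continuous_on_add)
next
  case (Suc k)
  have "Ck_on k U (partial i (\<lambda>x. f x + g x))" for i
  proof (rule Ck_on_cong[OF assms])
    show "Ck_on k U (\<lambda>x. partial i f x + partial i g x)" using Suc.prems by (intro Suc.IH) simp_all
  qed (use Suc.prems in \<open>simp add: partial_add\<close>)
  then show ?case using Suc.prems by simp
qed

lemma Ck_on_bilinear:
  assumes "bounded_bilinear pr" "open U"
  shows "Ck_on k U f \<Longrightarrow> Ck_on k U g \<Longrightarrow> Ck_on k U (\<lambda>x. pr (f x) (g x))"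
proof (induction k arbitrary: f g)
  case 0
  then show ?case by (simp add: bounded_bilinear.continuous_on[OF assms(1)])
next
  case (Suc k)
  have "(\<lambda>x. pr (f x) (g x)) differentiable (at x)" if "x \<in> U" for x
    using Suc.prems that by (intro differentiable_bilinear[OF assms(1)]) simp_all
  moreover have "Ck_on k U (partial i (\<lambda>x. pr (f x) (g x)))" for i
  proof (rule Ck_on_cong[OF assms(2)])
    show "Ck_on k U (\<lambda>x. pr (partial i f x) (g x) + pr (f x) (partial i g x))"
      using Suc.prems Ck_on_SucD[OF Suc.prems(1)] Ck_on_SucD[OF Suc.prems(2)]
      by (intro Ck_on_add[OF assms(2)] Suc.IH) simp_all
  qed (use Suc.prems in \<open>simp add: partial_bilinear[OF assms(1)]\<close>)
  ultimately show ?case by simp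
qed

lemma smooth_on_const [simp]: "smooth_on U (\<lambda>x. c)"
proof -
  have "Ck_on k U (\<lambda>x. c)" for k and c :: 'a
    by (induction k arbitrary: c) auto
  then show ?thesis by (simp add: smooth_on_def)
qed

lemma smooth_on_iff:
  "smooth_on U f \<longleftrightarrow> (\<forall>x\<in>U. f differentiable (at x)) \<and> (\<forall>i. smooth_on U (partial i f))"
  unfolding smooth_on_def by (metis Ck_on.simps(2) Ck_on_SucD)

lemma smooth_on_partial: "smooth_on U f \<Longrightarrow> smooth_on U (partial i f)"
  using smooth_on_iff by blast

lemma smooth_on_differentiable: "smooth_on U f \<Longrightarrow> x \<in> U \<Longrightarrow> f differentiable (at x)"
  using smooth_on_iff by blast

lemma smooth_on_continuous: "smooth_on U f \<Longrightarrow> continuous_on U f"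
  unfolding smooth_on_def by (metis Ck_on.simps(1))

lemma smooth_on_cong:
  "\<lbrakk>open U; \<And>x. x \<in> U \<Longrightarrow> f x = g x; smooth_on U f\<rbrakk> \<Longrightarrow> smooth_on U g"
  unfolding smooth_on_def by (metis Ck_on_cong)

lemma smooth_on_subset: "smooth_on U f \<Longrightarrow> V \<subseteq> U \<Longrightarrow> smooth_on V f"
  unfolding smooth_on_def by (metis Ck_on_subset)

lemma smooth_on_local:
  "(\<And>x. x \<in> U \<Longrightarrow> \<exists>V. open V \<and> x \<in> V \<and> smooth_on V f) \<Longrightarrow> smooth_on U f"
  unfolding smooth_on_def by (metis Ck_on_local)

lemma smooth_on_bounded_linear:
  "\<lbrakk>bounded_linear L; open U; smooth_on U f\<rbrakk> \<Longrightarrow> smooth_on U (\<lambda>x. L (f x))"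
  unfolding smooth_on_def by (metis Ck_on_bounded_linear)

lemma smooth_on_add:
  "\<lbrakk>open U; smooth_on U f; smooth_on U g\<rbrakk> \<Longrightarrow> smooth_on U (\<lambda>x. f x + g x)"
  unfolding smooth_on_def by (metis Ck_on_add)

lemma smooth_on_bilinear:
  "\<lbrakk>bounded_bilinear pr; open U; smooth_on U f; smooth_on U g\<rbrakk> \<Longrightarrow> smooth_on U (\<lambda>x. pr (f x) (g x))"
  unfolding smooth_on_def by (metis Ck_on_bilinear)

lemmas smooth_on_mult = smooth_on_bilinear[OF bounded_bilinear_mult]

lemma smooth_on_cmult: "\<lbrakk>open U; smooth_on U f\<rbrakk> \<Longrightarrow> smooth_on U (\<lambda>x. (c::real) * f x)"
  by (rule smooth_on_mult) auto

lemma smooth_on_diff: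
  assumes "open U" "smooth_on U f" "smooth_on U g"
  shows "smooth_on U (\<lambda>x. f x - g x)"
  using smooth_on_add[OF assms(1,2) smooth_on_bounded_linear[OF bounded_linear_minus[OF bounded_linear_ident] assms(1,3)]]
  by simp

lemma smooth_on_sum:
  assumes "open U" and "\<And>a. a \<in> A \<Longrightarrow> smooth_on U (f a)"
  shows "smooth_on U (\<lambda>x. \<Sum>a\<in>A. f a x)"
  using assms(2) by (induction A rule: infinite_finite_induct) (auto intro: smooth_on_add assms(1))

lemma smooth_on_ident: "smooth_on U (\<lambda>x. x)"
proof -
  have "partial i (\<lambda>x. x) = (\<lambda>x. axis i 1)" for i
    by (simp add: fun_eq_iff partial_def)
  then show ?thesis by (subst smooth_on_iff) simp
qed

lemma affine_has_derivative:
  "f differentiable (at (b + c *\<^sub>R x)) \<Longrightarrow>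
    ((\<lambda>x::real^2. f (b + c *\<^sub>R x)) has_derivative (\<lambda>h. frechet_derivative f (at (b + c *\<^sub>R x)) (c *\<^sub>R h))) (at x)"
  by (rule has_derivative_compose[of "\<lambda>x. b + c *\<^sub>R x" "\<lambda>h. c *\<^sub>R h"])
     (auto intro!: derivative_eq_intros simp: frechet_derivative_works[symmetric])

lemma partial_affine:
  assumes "f differentiable (at (b + c *\<^sub>R x))"
  shows "partial i (\<lambda>x. f (b + c *\<^sub>R x)) x = c *\<^sub>R partial i f (b + c *\<^sub>R x)"
  using partial_eqI[OF affine_has_derivative[OF assms], of i]
    linear_scale[OF linear_frechet_derivative[OF assms]]
  by (simp add: partial_def)

lemma smooth_affine:
  assumes "smooth_on UNIV f"
  shows "smooth_on UNIV (\<lambda>x. f (b + c *\<^sub>R x))"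
proof -
  have "Ck_on k UNIV f \<Longrightarrow> Ck_on k UNIV (\<lambda>x. f (b + c *\<^sub>R x))" for k and f :: "real^2 \<Rightarrow> 'a"
  proof (induction k arbitrary: f)
    case 0
    then show ?case
      by (auto intro!: continuous_on_compose2[of UNIV f] continuous_intros)
  next
    case (Suc k)
    have "(\<lambda>x. f (b + c *\<^sub>R x)) differentiable (at x)" for x
      using Suc.prems by (intro differentiableI[OF affine_has_derivative]) simp
    moreover have "Ck_on k UNIV (partial i (\<lambda>x. f (b + c *\<^sub>R x)))" for i
    proof (rule Ck_on_cong[OF open_UNIV])
      show "Ck_on k UNIV (\<lambda>x. c *\<^sub>R partial i f (b + c *\<^sub>R x))"
        using Suc.prems by (intro Ck_on_bounded_linear[OF bounded_linear_scaleR_right] Suc.IH open_UNIV) simp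
    qed (use Suc.prems in \<open>simp add: partial_affine\<close>)
    ultimately show ?case by simp
  qed
  then show ?thesis using assms by (simp add: smooth_on_def)
qed


section \<open>Symmetry of mixed partials\<close>

lemma partial_DERIV:
  fixes f :: "real^2 \<Rightarrow> real"
  assumes "f differentiable (at (a + u *\<^sub>R axis i 1))"
  shows "((\<lambda>u. f (a + u *\<^sub>R axis i 1)) has_real_derivative partial i f (a + u *\<^sub>R axis i 1)) (at u)"
proof -
  let ?x = "a + u *\<^sub>R axis i 1"
  have "((\<lambda>u. a + u *\<^sub>R axis i 1) has_derivative (\<lambda>h. h *\<^sub>R axis i 1)) (at u)"
    by (auto intro!: derivative_eq_intros)
  moreover have "(f has_derivative frechet_derivative f (at ?x)) (at ?x)"
    using assms by (simp add: frechet_derivative_works)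
  ultimately have "((\<lambda>u. f (a + u *\<^sub>R axis i 1)) has_derivative
      (\<lambda>h. frechet_derivative f (at ?x) (h *\<^sub>R axis i 1))) (at u)"
    by (rule has_derivative_compose)
  moreover have "frechet_derivative f (at ?x) (h *\<^sub>R axis i 1) = partial i f ?x * h" for h
    using linear_scale[OF linear_frechet_derivative[OF assms]] by (simp add: partial_def)
  ultimately show ?thesis by (simp add: has_field_derivative_def)
qed

text \<open>
  The second difference over a square of side \<open>s\<close> is, by the mean value theorem in each direction in
  turn, \<open>s\<^sup>2\<close> times a mixed partial at a nearby point.  Its left-hand side is symmetric in \<open>i\<close> and \<open>j\<close>,
  the order of the partials on the right depends on which direction comes first: letting \<open>s\<close> tend to 0
  gives the symmetry of the mixed partials.
\<close>

lemma second_difference_mean_value: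
  fixes f :: "real^2 \<Rightarrow> real"
  assumes f: "smooth_on UNIV f" and s: "s > 0"
  shows "\<exists>y. dist y x \<le> 2 * s \<and>
     f (x + s *\<^sub>R axis i 1 + s *\<^sub>R axis j 1) - f (x + s *\<^sub>R axis i 1) - f (x + s *\<^sub>R axis j 1) + f x
       = s^2 * partial j (partial i f) y"
proof -
  have d: "g differentiable (at y)" if "smooth_on UNIV g" for g :: "real^2 \<Rightarrow> real" and y
    using smooth_on_differentiable[OF that] by simp
  let ?p = "\<lambda>u. f ((x + s *\<^sub>R axis j 1) + u *\<^sub>R axis i 1) - f (x + u *\<^sub>R axis i 1)"
  have "\<exists>u>0. u < s \<and> ?p s - ?p 0 = (s - 0) *
      (partial i f ((x + s *\<^sub>R axis j 1) + u *\<^sub>R axis i 1) - partial i f (x + u *\<^sub>R axis i 1))"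
    using s by (intro MVT2) (auto intro!: DERIV_diff partial_DERIV d f)
  then obtain u where u: "0 < u" "u < s" and pu: "?p s - ?p 0 = s *
      (partial i f ((x + s *\<^sub>R axis j 1) + u *\<^sub>R axis i 1) - partial i f (x + u *\<^sub>R axis i 1))" by auto
  let ?q = "\<lambda>v. partial i f ((x + u *\<^sub>R axis i 1) + v *\<^sub>R axis j 1)"
  have "\<exists>v>0. v < s \<and> ?q s - ?q 0 = (s - 0) * partial j (partial i f) ((x + u *\<^sub>R axis i 1) + v *\<^sub>R axis j 1)"
    using s by (intro MVT2) (auto intro!: partial_DERIV d smooth_on_partial f)
  then obtain v where v: "0 < v" "v < s"
    and qv: "?q s - ?q 0 = s * partial j (partial i f) ((x + u *\<^sub>R axis i 1) + v *\<^sub>R axis j 1)" by auto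
  let ?y = "(x + u *\<^sub>R axis i 1) + v *\<^sub>R axis j 1"
  have "dist ?y x = norm (u *\<^sub>R axis i 1 + v *\<^sub>R axis j (1::real) :: real^2)"
    by (simp add: dist_norm algebra_simps)
  also have "\<dots> \<le> norm (u *\<^sub>R axis i (1::real) :: real^2) + norm (v *\<^sub>R axis j (1::real) :: real^2)" by (rule norm_triangle_ineq)
  also have "\<dots> \<le> 2 * s" using u v by simp
  finally have "dist ?y x \<le> 2 * s" .
  moreover have "f (x + s *\<^sub>R axis i 1 + s *\<^sub>R axis j 1) - f (x + s *\<^sub>R axis i 1) - f (x + s *\<^sub>R axis j 1) + f x
       = s^2 * partial j (partial i f) ?y"
    using pu qv by (simp add: power2_eq_square algebra_simps)
  ultimately show ?thesis by blast
qed

lemma partial_commute: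
  fixes f :: "real^2 \<Rightarrow> real"
  assumes f: "smooth_on UNIV f"
  shows "partial i (partial j f) = partial j (partial i f)"
proof
  fix x
  let ?\<Delta> = "\<lambda>i j s. f (x + s *\<^sub>R axis i 1 + s *\<^sub>R axis j 1) - f (x + s *\<^sub>R axis i 1) - f (x + s *\<^sub>R axis j 1) + f x"
  have "\<forall>i j s. \<exists>y. s > 0 \<longrightarrow> dist y x \<le> 2 * s \<and> ?\<Delta> i j s = s^2 * partial j (partial i f) y"
    using second_difference_mean_value[OF f, of _ x] by blast
  then obtain Y where "\<forall>i j s. s > 0 \<longrightarrow> dist (Y i j s) x \<le> 2 * s \<and>
      ?\<Delta> i j s = s^2 * partial j (partial i f) (Y i j s)"
    unfolding choice_iff by blast
  then have Y: "\<And>i j s. s > 0 \<Longrightarrow> dist (Y i j s) x \<le> 2 * s"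
    and YD: "\<And>i j s. s > 0 \<Longrightarrow> ?\<Delta> i j s = s^2 * partial j (partial i f) (Y i j s)"
    by blast+
  have lim: "((\<lambda>s. partial j (partial i f) (Y i j s)) \<longlongrightarrow> partial j (partial i f) x) (at_right 0)" for i j
  proof -
    have "((\<lambda>s. 2 * s) \<longlongrightarrow> 2 * 0) (at_right (0::real))" by (intro tendsto_intros)
    then have "((\<lambda>s. 2 * s) \<longlongrightarrow> 0) (at_right (0::real))" by simp
    moreover have "\<forall>\<^sub>F s in at_right (0::real). dist (Y i j s) x \<le> 2 * s"
      using eventually_at_right_less[of "0::real"] by (rule eventually_mono) (rule Y)
    ultimately have "((\<lambda>s. dist (Y i j s) x) \<longlongrightarrow> 0) (at_right 0)"
      by (intro tendsto_sandwich[of "\<lambda>_. 0" "\<lambda>s. dist (Y i j s) x" _ "\<lambda>s. 2 * s"]) simp_all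
    then have "((\<lambda>s. Y i j s) \<longlongrightarrow> x) (at_right 0)" by (subst tendsto_dist_iff)
    moreover have "isCont (partial j (partial i f)) x"
      using smooth_on_continuous[OF smooth_on_partial[OF smooth_on_partial[OF f]]]
      by (simp add: continuous_on_eq_continuous_at)
    ultimately show ?thesis by (rule isCont_tendsto_compose[rotated])
  qed
  have "partial j (partial i f) (Y i j s) = partial i (partial j f) (Y j i s)" if "s > 0" for s
    using YD[OF that, of i j] YD[OF that, of j i] that by (simp add: algebra_simps)
  then have "\<forall>\<^sub>F s in at_right 0. partial j (partial i f) (Y i j s) = partial i (partial j f) (Y j i s)"
    by (intro eventually_mono[OF eventually_at_right_less[of "0::real"]])
  from Lim_transform_eventually[OF lim this]
  have "((\<lambda>s. partial i (partial j f) (Y j i s)) \<longlongrightarrow> partial j (partial i f) x) (at_right 0)" .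
  from tendsto_unique[OF _ this lim] show "partial i (partial j f) x = partial j (partial i f) x"
    by simp
qed


section \<open>Supports and test functions\<close>

lemma closed_tsupp [simp]: "closed (tsupp \<phi>)"
  by (simp add: tsupp_def)

lemma not_in_tsupp: "x \<notin> tsupp \<phi> \<Longrightarrow> \<phi> x = 0"
  using closure_subset[of "support_on UNIV \<phi>"] by (auto simp: tsupp_def in_support_on)

lemma tsupp_subsetI: "closed C \<Longrightarrow> (\<And>x. x \<notin> C \<Longrightarrow> \<phi> x = 0) \<Longrightarrow> tsupp \<phi> \<subseteq> C"
  unfolding tsupp_def by (rule closure_minimal) (auto simp: support_on_def)

lemma partial_zero_off_tsupp: "x \<notin> tsupp \<phi> \<Longrightarrow> partial i \<phi> x = 0"
  using partial_cong_open[of "- tsupp \<phi>" x \<phi> "\<lambda>_. 0" i] by (simp add: not_in_tsupp open_Compl)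

lemma tsupp_partial: "tsupp (partial i \<phi>) \<subseteq> tsupp \<phi>"
  by (rule tsupp_subsetI) (auto simp: partial_zero_off_tsupp)

lemma test_functionsI:
  assumes "smooth_on UNIV \<phi>" "compact K" "K \<subseteq> U" "\<And>x. x \<notin> K \<Longrightarrow> \<phi> x = 0"
  shows "\<phi> \<in> test_functions U" "tsupp \<phi> \<subseteq> K"
proof -
  show K: "tsupp \<phi> \<subseteq> K" by (rule tsupp_subsetI) (use assms compact_imp_closed in auto)
  then have "compact (tsupp \<phi>)"
    using compact_Int_closed[OF assms(2) closed_tsupp[of \<phi>]] by (simp add: Int_absorb1)
  then show "\<phi> \<in> test_functions U" using K assms by (auto simp: test_functions_def)
qed

lemma test_functionsD:
  assumes "\<phi> \<in> test_functions U"
  shows "smooth_on UNIV \<phi>" "compact (tsupp \<phi>)" "tsupp \<phi> \<subseteq> U"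
  using assms by (auto simp: test_functions_def)

lemma test_functions_mono: "\<phi> \<in> test_functions U \<Longrightarrow> tsupp \<phi> \<subseteq> V \<Longrightarrow> \<phi> \<in> test_functions V"
  by (auto simp: test_functions_def)

lemma test_functions_partial: "\<phi> \<in> test_functions U \<Longrightarrow> partial i \<phi> \<in> test_functions U"
  by (rule test_functionsI[of _ "tsupp \<phi>"])
     (auto dest: test_functionsD simp: partial_zero_off_tsupp intro: smooth_on_partial)

lemma test_functions_add:
  assumes "\<phi> \<in> test_functions U" "\<psi> \<in> test_functions U"
  shows "(\<lambda>x. \<phi> x + \<psi> x) \<in> test_functions U"
  by (rule test_functionsI[of _ "tsupp \<phi> \<union> tsupp \<psi>"])
     (use assms[THEN test_functionsD(1)] assms[THEN test_functionsD(2)] assms[THEN test_functionsD(3)]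
       in \<open>auto intro: smooth_on_add simp: not_in_tsupp\<close>)

lemma test_functions_cmult:
  "\<phi> \<in> test_functions U \<Longrightarrow> (\<lambda>x. (c::real) * \<phi> x) \<in> test_functions U"
  by (rule test_functionsI[of _ "tsupp \<phi>"])
     (auto dest: test_functionsD simp: not_in_tsupp intro: smooth_on_cmult)

lemma test_functions_zero: "(\<lambda>x. 0) \<in> test_functions U"
  by (rule test_functionsI[of _ "{}"]) auto

lemma test_functions_sum:
  assumes "\<And>a. a \<in> A \<Longrightarrow> \<phi> a \<in> test_functions U"
  shows "(\<lambda>x. \<Sum>a\<in>A. \<phi> a x) \<in> test_functions U"
  using assms by (induction A rule: infinite_finite_induct) (auto intro: test_functions_add test_functions_zero)

text \<open>
  The product is smooth on the whole plane although \<open>g\<close> is arbitrary outside \<open>U\<close>: the open sets \<open>U\<close> and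
  the complement of the support of \<open>\<phi>\<close> cover the plane, and on the latter the product is zero.
\<close>

lemma test_functions_scaleR:
  assumes "open U" and \<phi>: "\<phi> \<in> test_functions U" and g: "smooth_on U g"
  shows "(\<lambda>x. \<phi> x *\<^sub>R g x) \<in> test_functions U" "tsupp (\<lambda>x. \<phi> x *\<^sub>R g x) \<subseteq> tsupp \<phi>"
proof -
  have "smooth_on UNIV (\<lambda>x. \<phi> x *\<^sub>R g x)"
  proof (rule smooth_on_local)
    fix x :: "real^2"
    show "\<exists>V. open V \<and> x \<in> V \<and> smooth_on V (\<lambda>x. \<phi> x *\<^sub>R g x)"
    proof (cases "x \<in> U")
      case True
      moreover have "smooth_on U (\<lambda>x. \<phi> x *\<^sub>R g x)"
        using smooth_on_subset[OF test_functionsD(1)[OF \<phi>], of U]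
        by (intro smooth_on_bilinear[OF bounded_bilinear_scaleR] assms) auto
      ultimately show ?thesis using assms(1) by blast
    next
      case False
      then have "x \<in> - tsupp \<phi>" using test_functionsD(3)[OF \<phi>] by blast
      moreover have "smooth_on (- tsupp \<phi>) (\<lambda>x. \<phi> x *\<^sub>R g x)"
        by (rule smooth_on_cong[OF _ _ smooth_on_const[of _ 0]]) (auto simp: not_in_tsupp open_Compl)
      ultimately show ?thesis by (metis closed_tsupp open_Compl)
    qed
  qed
  from test_functionsI[OF this test_functionsD(2,3)[OF \<phi>]]
  show "(\<lambda>x. \<phi> x *\<^sub>R g x) \<in> test_functions U" "tsupp (\<lambda>x. \<phi> x *\<^sub>R g x) \<subseteq> tsupp \<phi>"
    by (auto simp: not_in_tsupp)
qed

lemmas test_functions_mult =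
  test_functions_scaleR[where g = "g :: real^2 \<Rightarrow> real" for g, unfolded real_scaleR_def]


section \<open>Iterated partials\<close>

text \<open>
  Words of directions instead of multi-indices: derivatives can then be added at either end of the
  word without commuting partials, which makes inductions over the order simple.  For smooth
  functions only the number of occurrences of each direction matters (\<open>word_partial_eq_mpartial\<close>).
\<close>

definition word_partial :: "2 list \<Rightarrow> (real^2 \<Rightarrow> real) \<Rightarrow> real^2 \<Rightarrow> real" where
  "word_partial is f = foldr partial is f"

lemma word_partial_Nil [simp]: "word_partial [] f = f"
  and word_partial_Cons: "word_partial (i # is) f = partial i (word_partial is f)"
  and word_partial_append: "word_partial (is @ js) f = word_partial is (word_partial js f)"
  by (simp_all add: word_partial_def)

lemma word_partial_snoc: "word_partial (is @ [i]) f = word_partial is (partial i f)"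
  by (simp add: word_partial_append word_partial_Cons)

lemma smooth_word_partial: "smooth_on UNIV f \<Longrightarrow> smooth_on UNIV (word_partial is f)"
  by (induction "is") (auto simp: word_partial_Cons intro: smooth_on_partial)

lemma word_partial_add:
  assumes "smooth_on UNIV f" "smooth_on UNIV g"
  shows "word_partial is (\<lambda>x. f x + g x) = (\<lambda>x. word_partial is f x + word_partial is g x)"
proof (induction "is")
  case (Cons i "is")
  show ?case
    unfolding word_partial_Cons Cons.IH
    by (rule ext, rule partial_add) (auto intro: smooth_on_differentiable[of UNIV] smooth_word_partial assms)
qed simp

lemma word_partial_cmult:
  assumes "smooth_on UNIV f"
  shows "word_partial is (\<lambda>x. c * f x) = (\<lambda>x. c * word_partial is f x)"
proof (induction "is")
  case (Cons i "is")
  show ?case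
    unfolding word_partial_Cons Cons.IH
    by (rule ext, rule partial_bounded_linear[OF bounded_linear_mult_right])
       (auto intro: smooth_on_differentiable[of UNIV] smooth_word_partial assms)
qed simp

lemma word_partial_zero [simp]: "word_partial is (\<lambda>x. 0) = (\<lambda>x. 0)"
  using word_partial_cmult[of "\<lambda>x. 0" "is" 0] by simp

lemma word_partial_sum:
  assumes "\<And>a. a \<in> A \<Longrightarrow> smooth_on UNIV (f a)"
  shows "word_partial is (\<lambda>x. \<Sum>a\<in>A. f a x) = (\<lambda>x. \<Sum>a\<in>A. word_partial is (f a) x)"
  using assms
proof (induction A rule: infinite_finite_induct)
  case (insert a A)
  then show ?case by (simp add: word_partial_add smooth_on_sum)
qed simp_all

lemma word_partial_affine:
  assumes "smooth_on UNIV f"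
  shows "word_partial is (\<lambda>x. f (b + c *\<^sub>R x)) = (\<lambda>x. c ^ length is * word_partial is f (b + c *\<^sub>R x))"
proof (induction "is")
  case (Cons i "is")
  have d: "word_partial is f differentiable (at y)" for y
    using smooth_on_differentiable[OF smooth_word_partial[OF assms]] by simp
  have "partial i (\<lambda>x. c ^ length is * word_partial is f (b + c *\<^sub>R x)) x =
      c ^ length is * partial i (\<lambda>x. word_partial is f (b + c *\<^sub>R x)) x" for x
    by (rule partial_bounded_linear[OF bounded_linear_mult_right])
       (rule differentiableI[OF affine_has_derivative[OF d]])
  then show ?case by (simp add: word_partial_Cons Cons fun_eq_iff partial_affine[OF d])
qed simp

lemma word_partial_cong_open:
  assumes "open U" "\<And>y. y \<in> U \<Longrightarrow> f y = g y" "x \<in> U"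
  shows "word_partial is f x = word_partial is g x"
  using assms(3)
  by (induction "is" arbitrary: x) (auto simp: assms word_partial_Cons intro: partial_cong_open[OF assms(1)])

lemma mpartial_eq_word_partial: "mpartial \<alpha> f = word_partial (replicate (fst \<alpha>) 1 @ replicate (snd \<alpha>) 2) f"
proof -
  have "(partial i ^^ n) g = word_partial (replicate n i) g" for i n g
    by (induction n) (auto simp: word_partial_Cons)
  then show ?thesis by (simp add: mpartial_def word_partial_append)
qed

lemma word_partial_eq_mpartial:
  "\<exists>\<alpha>. mlen \<alpha> = length is \<and> (\<forall>f. smooth_on UNIV f \<longrightarrow> word_partial is f = mpartial \<alpha> f)"
proof (induction "is")
  case Nil
  show ?case by (rule exI[of _ "(0,0)"]) (simp add: mlen_def mpartial_def)
next
  case (Cons i "is")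
  then obtain a b where ab: "a + b = length is"
    and eq: "\<And>f. smooth_on UNIV f \<Longrightarrow> word_partial is f = mpartial (a,b) f" by (auto simp: mlen_def)
  show ?case
  proof (cases "i = 1")
    case True
    then show ?thesis
      by (intro exI[of _ "(Suc a, b)"]) (simp add: ab mlen_def word_partial_Cons eq, simp add: mpartial_def)
  next
    case False
    then have i: "i = 2" using exhaust_2 by blast
    have comm: "partial 2 ((partial 1 ^^ a) g) = (partial 1 ^^ a) (partial 2 g)"
      and "smooth_on UNIV ((partial 1 ^^ a) g)" if "smooth_on UNIV g" for g :: "real^2 \<Rightarrow> real"
      by (induction a) (simp_all add: that smooth_on_partial partial_commute[of _ 2 1])
    have sm: "smooth_on UNIV ((partial 2 ^^ b) f)" if "smooth_on UNIV f" for f :: "real^2 \<Rightarrow> real"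
      by (induction b) (simp_all add: that smooth_on_partial)
    show ?thesis
      by (intro exI[of _ "(a, Suc b)"]) (simp add: ab mlen_def word_partial_Cons eq i, simp add: mpartial_def comm sm)
  qed
qed


section \<open>Smooth cutoff functions\<close>

text \<open>
  The flat function \<open>exp (- 1/t)\<close>, extended by 0, with a polynomial factor in \<open>1/t\<close>.  The factor makes
  the family closed under differentiation, so that smoothness follows from one derivative.
\<close>

definition flat_exp :: "real poly \<Rightarrow> real \<Rightarrow> real" where
  "flat_exp p t = (if t > 0 then poly p (inverse t) * exp (- inverse t) else 0)"

lemma poly_times_exp_tendsto_0: "((\<lambda>s. poly p s * exp (- s)) \<longlongrightarrow> (0::real)) at_top"
proof -
  have "((\<lambda>s. \<Sum>i\<le>degree p. coeff p i * (s ^ i / exp s)) \<longlongrightarrow> (\<Sum>i\<le>degree p. coeff p i * 0)) at_top"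
    by (intro tendsto_intros tendsto_power_div_exp_0)
  then show ?thesis by (simp add: poly_altdef sum_distrib_right exp_minus divide_inverse mult.assoc)
qed

text \<open>
  Since \<open>1/t\<close> has the derivative \<open>- (1/t)\<^sup>2\<close>, differentiation replaces the polynomial \<open>p\<close> by
  \<open>X\<^sup>2 (p - p')\<close>.  At 0 the difference quotient from the right is again a polynomial in \<open>1/t\<close> times
  \<open>exp (- 1/t)\<close>, which tends to 0.
\<close>

lemma DERIV_flat_exp:
  "(flat_exp p has_real_derivative flat_exp ([:0, 0, 1:] * (p - pderiv p)) t) (at t)"
proof -
  consider "t > 0" | "t < 0" | "t = 0" by linarith
  then show ?thesis
  proof cases
    case 1
    have "((\<lambda>t. poly p (inverse t) * exp (- inverse t)) has_real_derivative
        flat_exp ([:0, 0, 1:] * (p - pderiv p)) t) (at t)"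
      using 1 by (auto intro!: derivative_eq_intros simp: flat_exp_def field_simps power2_eq_square)
    then show ?thesis
      by (rule has_field_derivative_transform_within_open[where S = "{0<..}"])
         (use 1 in \<open>auto simp: flat_exp_def\<close>)
  next
    case 2
    have "((\<lambda>t. 0) has_real_derivative flat_exp ([:0, 0, 1:] * (p - pderiv p)) t) (at t)"
      using 2 by (simp add: flat_exp_def)
    then show ?thesis
      by (rule has_field_derivative_transform_within_open[where S = "{..<0}"])
         (use 2 in \<open>auto simp: flat_exp_def\<close>)
  next
    case 3
    have "((\<lambda>h. poly (pCons 0 p) (inverse h) * exp (- inverse h)) \<longlongrightarrow> 0) (at_right 0)"
      by (rule filterlim_compose[OF poly_times_exp_tendsto_0 filterlim_inverse_at_top_right])
    then have "((\<lambda>h. flat_exp p h / h) \<longlongrightarrow> 0) (at_right 0)"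
      by (rule Lim_transform_eventually)
         (rule eventually_mono[OF eventually_at_right_less[of "0::real"]], simp add: flat_exp_def field_simps)
    moreover have "((\<lambda>h. flat_exp p h / h) \<longlongrightarrow> 0) (at_left 0)"
      by (rule Lim_transform_eventually[OF tendsto_const])
         (rule eventually_mono[OF eventually_at_leftI[of "-1" "0::real" "\<lambda>h. h < 0"]], simp_all add: flat_exp_def)
    ultimately have "((\<lambda>h. flat_exp p h / h) \<longlongrightarrow> 0) (at 0)"
      by (simp add: filterlim_split_at)
    then show ?thesis by (simp add: 3 has_field_derivative_iff flat_exp_def[of _ 0])
  qed
qed

text \<open>
  \<open>H n\<close> is the \<open>n\<close>-th derivative of \<open>H 0\<close>.  Stating the lemma for all \<open>n\<close> at once lets the induction on the
  order of differentiability pass from \<open>H n\<close> to \<open>H (Suc n)\<close> under the chain rule.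
\<close>

lemma smooth_on_compose_real:
  fixes H :: "nat \<Rightarrow> real \<Rightarrow> real"
  assumes H: "\<And>n t. (H n has_real_derivative H (Suc n) t) (at t)" and g: "smooth_on UNIV g"
  shows "smooth_on UNIV (\<lambda>x. H n (g x))"
proof -
  have D: "((\<lambda>x. H n (g x)) has_derivative (\<lambda>h. H (Suc n) (g x) * frechet_derivative g (at x) h)) (at x)" for n x
  proof -
    have "(H n has_derivative (*) (H (Suc n) (g x))) (at (g x))"
      using H by (simp add: has_field_derivative_def)
    moreover have "(g has_derivative frechet_derivative g (at x)) (at x)"
      using smooth_on_differentiable[OF g] by (simp add: frechet_derivative_works)
    ultimately show ?thesis using has_derivative_compose by blast
  qed
  have P: "partial i (\<lambda>x. H n (g x)) = (\<lambda>x. H (Suc n) (g x) * partial i g x)" for i n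
    using partial_eqI[OF D, of i] by (simp add: fun_eq_iff partial_def)
  have "Ck_on k UNIV (\<lambda>x. H n (g x))" for k
  proof (induction k arbitrary: n)
    case 0
    have "isCont (\<lambda>x. H n (g x)) x" for x
      using has_derivative_continuous[OF D] by blast
    then show ?case by (simp add: continuous_at_imp_continuous_on)
  next
    case (Suc k)
    have "Ck_on k UNIV (partial i g)" for i
      using smooth_on_partial[OF g] by (simp add: smooth_on_def)
    then have "Ck_on k UNIV (partial i (\<lambda>x. H n (g x)))" for i
      unfolding P by (intro Ck_on_bilinear[OF bounded_bilinear_mult] Suc.IH open_UNIV)
    then show ?case using D by (auto intro: differentiableI)
  qed
  then show ?thesis by (simp add: smooth_on_def)
qed

lemma smooth_on_flat_exp:
  assumes "smooth_on UNIV g"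
  shows "smooth_on UNIV (\<lambda>x. flat_exp 1 (g x))"
proof -
  define H where "H n = flat_exp (((\<lambda>p. [:0, 0, 1:] * (p - pderiv p)) ^^ n) 1)" for n :: nat
  have "(H n has_real_derivative H (Suc n) t) (at t)" for n t
    unfolding H_def using DERIV_flat_exp by simp
  from smooth_on_compose_real[of H, OF this assms, of 0] show ?thesis by (simp add: H_def)
qed

lemma flat_exp_mono: "s \<le> t \<Longrightarrow> flat_exp 1 s \<le> flat_exp 1 t"
  by (auto simp: flat_exp_def)

lemma flat_exp_pos: "t > 0 \<Longrightarrow> flat_exp 1 t > 0"
  by (simp add: flat_exp_def)

lemma flat_exp_nonneg: "flat_exp 1 t \<ge> 0"
  by (simp add: flat_exp_def)

lemma flat_exp_zero: "t \<le> 0 \<Longrightarrow> flat_exp p t = 0"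
  by (simp add: flat_exp_def)

text \<open>
  With \<open>f t = exp (- 1/t)\<close> for \<open>t > 0\<close> and 0 otherwise, the cutoff is \<open>f (f 3 - f (4\<bar>x\<bar>\<^sup>2 - 1))\<close> up to a
  constant factor.  For \<open>\<bar>x\<bar> \<le> 1/2\<close> the inner \<open>f\<close> is 0 and the value is the constant \<open>f (f 3)\<close>; for
  \<open>\<bar>x\<bar> \<ge> 1\<close> its argument is at least 3 and the outer argument is not positive.  Composing \<open>f\<close> with
  itself avoids quotients and integrals of smooth functions.
\<close>

lemma smooth_cutoff:
  obtains \<eta> :: "real^2 \<Rightarrow> real" where "smooth_on UNIV \<eta>" "\<And>x. 0 \<le> \<eta> x"
    "\<And>x. norm x \<le> 1/2 \<Longrightarrow> \<eta> x = 1" "\<And>x. norm x \<ge> 1 \<Longrightarrow> \<eta> x = 0"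
proof
  let ?f = "flat_exp 1"
  let ?\<eta> = "\<lambda>x::real^2. inverse (?f (?f 3)) * ?f (?f 3 - ?f (4 * (x \<bullet> x) - 1))"
  have c: "?f (?f 3) > 0" by (simp add: flat_exp_pos)
  show "smooth_on UNIV ?\<eta>"
    by (intro smooth_on_cmult smooth_on_flat_exp smooth_on_diff smooth_on_const
        smooth_on_bilinear[OF bounded_bilinear_inner] smooth_on_ident open_UNIV)
  fix x :: "real^2"
  show "0 \<le> ?\<eta> x" using c by (simp add: flat_exp_nonneg)
  show "?\<eta> x = 1" if "norm x \<le> 1/2"
  proof -
    have "x \<bullet> x \<le> (1/2)^2" using that power_mono[of "norm x" "1/2" 2] by (simp add: power2_norm_eq_inner)
    then show ?thesis using c by (simp add: flat_exp_zero power2_eq_square)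
  qed
  show "?\<eta> x = 0" if "norm x \<ge> 1"
  proof -
    have "x \<bullet> x \<ge> 1^2" using that power_mono[of 1 "norm x" 2] by (simp add: power2_norm_eq_inner)
    then show ?thesis using flat_exp_mono[of 3 "4 * (x \<bullet> x) - 1"] by (simp add: flat_exp_zero)
  qed
qed

lemma bump_at:
  fixes x0 :: "real^2"
  assumes "e > 0"
  obtains \<eta> where "smooth_on UNIV \<eta>" "\<And>x. 0 \<le> \<eta> x" "\<And>x. x \<in> cball x0 (e/2) \<Longrightarrow> \<eta> x = (1::real)"
    "\<And>x. x \<notin> cball x0 e \<Longrightarrow> \<eta> x = 0"
proof -
  obtain \<eta> :: "real^2 \<Rightarrow> real" where \<eta>: "smooth_on UNIV \<eta>" "\<And>x. 0 \<le> \<eta> x"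
    "\<And>x. norm x \<le> 1/2 \<Longrightarrow> \<eta> x = 1" "\<And>x. norm x \<ge> 1 \<Longrightarrow> \<eta> x = 0" by (rule smooth_cutoff) blast
  have n: "norm (- (1/e) *\<^sub>R x0 + (1/e) *\<^sub>R x) = dist x0 x / e" for x
  proof -
    have "- (1/e) *\<^sub>R x0 + (1/e) *\<^sub>R x = (1/e) *\<^sub>R (x - x0)" by (simp add: algebra_simps)
    then show ?thesis using assms by (simp add: dist_norm norm_minus_commute)
  qed
  show ?thesis
  proof
    let ?\<eta> = "\<lambda>x. \<eta> (- (1/e) *\<^sub>R x0 + (1/e) *\<^sub>R x)"
    show "smooth_on UNIV ?\<eta>" by (rule smooth_affine[OF \<eta>(1)])
    show "0 \<le> ?\<eta> x" for x by (rule \<eta>(2))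
    show "?\<eta> x = 1" if "x \<in> cball x0 (e/2)" for x
      by (rule \<eta>(3), subst n) (use that assms in \<open>simp add: field_simps\<close>)
    show "?\<eta> x = 0" if "x \<notin> cball x0 e" for x
      by (rule \<eta>(4), subst n) (use that assms in \<open>simp add: field_simps\<close>)
  qed
qed


section \<open>Integration against test functions\<close>

lemma test_function_integrable:
  fixes g :: "real^2 \<Rightarrow> 'b::euclidean_space"
  assumes "\<phi> \<in> test_functions U" "continuous_on U g"
  shows "integrable lborel (\<lambda>x. \<phi> x *\<^sub>R g x)"
proof -
  have "continuous_on (tsupp \<phi>) (\<lambda>x. \<phi> x *\<^sub>R g x)"
    using test_functionsD[OF assms(1)] assms(2)
    by (intro continuous_on_scaleR) (auto intro: continuous_on_subset dest: smooth_on_continuous)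
  from borel_integrable_compact[OF test_functionsD(2)[OF assms(1)] this]
  have "integrable lborel (\<lambda>x. indicator (tsupp \<phi>) x *\<^sub>R \<phi> x *\<^sub>R g x)" .
  moreover have "indicator (tsupp \<phi>) x *\<^sub>R \<phi> x *\<^sub>R g x = \<phi> x *\<^sub>R g x" for x
    by (cases "x \<in> tsupp \<phi>") (simp_all add: not_in_tsupp)
  ultimately show ?thesis by (simp only:)
qed

lemma test_function_bounded:
  fixes \<phi> :: "real^2 \<Rightarrow> real"
  assumes "\<phi> \<in> test_functions U"
  obtains M where "M \<ge> 0" "\<And>x. \<bar>\<phi> x\<bar> \<le> M"
proof -
  have "compact (\<phi> ` tsupp \<phi>)"
    by (rule compact_continuous_image)
       (use test_functionsD[OF assms] in \<open>auto intro: continuous_on_subset dest: smooth_on_continuous\<close>)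
  then obtain M where M: "\<forall>y\<in>\<phi> ` tsupp \<phi>. \<bar>y\<bar> \<le> M"
    using compact_imp_bounded bounded_real by metis
  show ?thesis
  proof (rule that[of "max M 0"])
    fix x show "\<bar>\<phi> x\<bar> \<le> max M 0"
    proof (cases "x \<in> tsupp \<phi>")
      case True
      then have "\<bar>\<phi> x\<bar> \<le> M" using M by blast
      then show ?thesis by simp
    qed (simp add: not_in_tsupp)
  qed simp
qed

lemma lborel_integral_translate:
  fixes h :: "real^2 \<Rightarrow> real"
  assumes "h \<in> borel_measurable borel"
  shows "(LINT x|lborel. h (c + x)) = (LINT x|lborel. h x)"
proof -
  have "(LINT x|lborel. h x) = (LINT x|distr lborel borel ((+) c). h x)"
    by (simp add: lborel_distr_plus)
  also have "\<dots> = (LINT x|lborel. h (c + x))"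
    by (rule integral_distr) (use assms in auto)
  finally show ?thesis by simp
qed

text \<open>
  By translation invariance the difference quotients of \<open>h\<close> in direction \<open>i\<close> have integral 0.  They
  converge to the partial derivative and, by the mean value theorem, are dominated by a bound for it
  on a ball that contains the support with a margin of 1, as the increments are at most 1.
\<close>

lemma integral_partial_zero:
  fixes h :: "real^2 \<Rightarrow> real"
  assumes h: "h \<in> test_functions UNIV"
  shows "(LINT x|lborel. partial i h x) = 0"
proof -
  let ?e = "axis i 1 :: real^2"
  let ?s = "\<lambda>n x. (h (x + inverse (real (Suc n)) *\<^sub>R ?e) - h x) / inverse (real (Suc n))"
  note sm = test_functionsD(1)[OF h]
  have d: "h differentiable (at x)" for x using smooth_on_differentiable[OF sm] by simp
  obtain M where M: "M \<ge> 0" "\<And>x. \<bar>partial i h x\<bar> \<le> M"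
    using test_function_bounded[OF test_functions_partial[OF h]] by blast
  obtain R where "\<forall>x\<in>tsupp h. norm x \<le> R"
    using compact_imp_bounded[OF test_functionsD(2)[OF h]] bounded_iff by blast
  then have R: "tsupp h \<subseteq> cball 0 R" by auto
  have hint: "integrable lborel h"
    using test_function_integrable[OF h, of "\<lambda>_. 1::real"] by simp
  have hmeas: "h \<in> borel_measurable borel"
    using smooth_on_continuous[OF sm] by (rule borel_measurable_continuous_onI)
  have "(\<lambda>n. LINT x|lborel. ?s n x) \<longlonglongrightarrow> (LINT x|lborel. partial i h x)"
  proof (rule integral_dominated_convergence)
    show "partial i h \<in> borel_measurable lborel"
      using smooth_on_continuous[OF smooth_on_partial[OF sm]] by (simp add: borel_measurable_continuous_onI)
    show "?s n \<in> borel_measurable lborel" for n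
      using smooth_on_continuous[OF sm]
      by (simp, intro borel_measurable_continuous_onI continuous_intros)
         (auto intro: continuous_on_compose2[of UNIV h] intro!: continuous_intros)
    have "integrable lborel (\<lambda>x. indicator (cball 0 (R + 1)) x *\<^sub>R M)"
      by (rule borel_integrable_compact) auto
    then show "integrable lborel (\<lambda>x::real^2. M * indicator (cball 0 (R + 1)) x)"
      by (simp add: mult.commute)
    show "AE x in lborel. (\<lambda>n. ?s n x) \<longlonglongrightarrow> partial i h x"
    proof (rule AE_I2)
      fix x
      have "((\<lambda>u. h (x + u *\<^sub>R ?e)) has_real_derivative partial i h x) (at 0)"
        using partial_DERIV[of h x 0 i] d by simp
      then have "((\<lambda>u. (h (x + u *\<^sub>R ?e) - h x) / u) \<longlongrightarrow> partial i h x) (at 0)"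
        by (simp add: has_field_derivative_iff)
      moreover have "filterlim (\<lambda>n. inverse (real (Suc n))) (at 0) sequentially"
        by (simp add: filterlim_at LIMSEQ_inverse_real_of_nat del: of_nat_Suc)
      ultimately show "(\<lambda>n. ?s n x) \<longlonglongrightarrow> partial i h x" by (rule filterlim_compose)
    qed
    show "AE x in lborel. norm (?s n x) \<le> M * indicator (cball 0 (R + 1)) x" for n
    proof (rule AE_I2)
      fix x
      let ?u = "inverse (real (Suc n))"
      have u: "?u > 0" "?u \<le> 1" by (auto simp: field_simps)
      show "norm (?s n x) \<le> M * indicator (cball 0 (R + 1)) x"
      proof (cases "x \<in> cball 0 (R + 1)")
        case True
        obtain v where "h (x + ?u *\<^sub>R ?e) - h (x + 0 *\<^sub>R ?e) = (?u - 0) * partial i h (x + v *\<^sub>R ?e)"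
          using MVT2[OF u(1), of "\<lambda>u. h (x + u *\<^sub>R ?e)" "\<lambda>u. partial i h (x + u *\<^sub>R ?e)"] partial_DERIV[OF d]
          by blast
        then have "?s n x = partial i h (x + v *\<^sub>R ?e)" using u(1) by simp
        then show ?thesis using M(2) True by simp
      next
        case False
        have "norm x \<le> norm (x + ?u *\<^sub>R ?e) + norm (?u *\<^sub>R ?e)"
          using norm_triangle_ineq4[of "x + ?u *\<^sub>R ?e" "?u *\<^sub>R ?e"] by simp
        then have "x + ?u *\<^sub>R ?e \<notin> cball 0 R" "x \<notin> cball 0 R" using False u by auto
        then have "h (x + ?u *\<^sub>R ?e) = 0" "h x = 0" using R by (blast intro: not_in_tsupp)+
        then show ?thesis using M(1) by simp
      qed
    qed
  qed
  moreover have "(LINT x|lborel. ?s n x) = 0" for n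
  proof -
    let ?c = "inverse (real (Suc n)) *\<^sub>R ?e"
    have tr: "(LINT x|lborel. h (x + ?c)) = (LINT x|lborel. h x)"
      using lborel_integral_translate[OF hmeas, of ?c] by (simp add: add.commute)
    have "integrable lborel (\<lambda>x. h (x + ?c))"
    proof -
      have "integrable (distr lborel borel ((+) ?c)) h" using hint by (simp add: lborel_distr_plus)
      then have "integrable lborel (\<lambda>x. h (?c + x))" by (subst (asm) integrable_distr_eq) (use hmeas in auto)
      then show ?thesis by (simp add: add.commute)
    qed
    then show ?thesis using hint tr by simp
  qed
  ultimately show ?thesis using LIMSEQ_unique[OF tendsto_const[of 0 sequentially]] by simp
qed

text \<open>The product \<open>\<phi> g\<close> is itself a test function, so the integral of its partial derivative is 0.\<close>

lemma integration_by_parts: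
  fixes g :: "real^2 \<Rightarrow> real"
  assumes U: "open U" and \<phi>: "\<phi> \<in> test_functions U" and g: "smooth_on U g"
  shows "(LINT x|lborel. partial i \<phi> x * g x) = - (LINT x|lborel. \<phi> x * partial i g x)"
proof -
  have "partial i (\<lambda>x. \<phi> x * g x) x = partial i \<phi> x * g x + \<phi> x * partial i g x" for x
  proof (cases "x \<in> U")
    case True
    then show ?thesis
      using smooth_on_differentiable[OF g True] smooth_on_differentiable[OF test_functionsD(1)[OF \<phi>], of x]
      by (simp add: partial_bilinear[OF bounded_bilinear_mult])
  next
    case False
    then have x: "x \<notin> tsupp \<phi>" using test_functionsD(3)[OF \<phi>] by blast
    then have "x \<notin> tsupp (\<lambda>x. \<phi> x * g x)" using test_functions_mult(2)[OF U \<phi> g] by blast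
    then show ?thesis using x by (simp add: partial_zero_off_tsupp not_in_tsupp)
  qed
  moreover have "(\<lambda>x. \<phi> x * g x) \<in> test_functions UNIV"
    using test_functions_mult(1)[OF U \<phi> g] by (rule test_functions_mono) simp
  ultimately have "(LINT x|lborel. partial i \<phi> x * g x + \<phi> x * partial i g x) = 0"
    using integral_partial_zero[of "\<lambda>x. \<phi> x * g x" i] by simp
  moreover have "integrable lborel (\<lambda>x. partial i \<phi> x * g x)" "integrable lborel (\<lambda>x. \<phi> x * partial i g x)"
    using test_function_integrable[OF test_functions_partial[OF \<phi>] smooth_on_continuous[OF g], of i]
      test_function_integrable[OF \<phi> smooth_on_continuous[OF smooth_on_partial[OF g, of i]]] by simp_all
  ultimately show ?thesis by simp
qed

text \<open>
  If \<open>g x0 \<noteq> 0\<close>, then \<open>g x * g x0\<close> is bounded below by a positive constant near \<open>x0\<close>, and integrating it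
  against a bump function at \<open>x0\<close> gives a positive number.
\<close>

lemma fundamental_lemma_real:
  fixes g :: "real^2 \<Rightarrow> real"
  assumes U: "open U" and g: "continuous_on U g"
    and zero: "\<And>\<phi>. \<phi> \<in> test_functions U \<Longrightarrow> (LINT x|lborel. \<phi> x * g x) = 0"
    and x0: "x0 \<in> U"
  shows "g x0 = 0"
proof (rule ccontr)
  assume nz: "g x0 \<noteq> 0"
  \<comment> \<open>Half the value of \<open>g x * g x0\<close> at \<open>x0\<close>, so that the bound persists nearby.\<close>
  define d where "d = (g x0)^2 / 2"
  have "g x0 * g x0 > 0" using nz zero_less_power2[of "g x0"] by (simp add: power2_eq_square)
  then have d: "d > 0" "g x0 * g x0 > d" by (simp_all add: d_def power2_eq_square)
  have "isCont (\<lambda>x. g x * g x0) x0"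
    using g U x0 by (intro isCont_mult continuous_const) (simp add: continuous_on_eq_continuous_at)
  then have "\<forall>\<^sub>F x in at x0. g x * g x0 > d" using d(2) by (simp add: isCont_def order_tendstoD)
  then obtain e1 where "e1 > 0" "\<And>x. x \<noteq> x0 \<Longrightarrow> dist x x0 < e1 \<Longrightarrow> g x * g x0 > d"
    unfolding eventually_at by auto
  then have e1: "e1 > 0" "\<And>x. dist x x0 < e1 \<Longrightarrow> g x * g x0 > d" using d(2) by metis+
  obtain e2 where e2: "e2 > 0" "cball x0 e2 \<subseteq> U" using U x0 open_contains_cball by blast
  define e where "e = min (e1/2) e2"
  have e: "e > 0" "cball x0 e \<subseteq> U" "\<And>x. x \<in> cball x0 e \<Longrightarrow> g x * g x0 > d"
    using e1 e2 by (auto simp: e_def dist_commute)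
  obtain \<eta> where \<eta>: "smooth_on UNIV \<eta>" "\<And>x. 0 \<le> \<eta> x" "\<And>x. x \<in> cball x0 (e/2) \<Longrightarrow> \<eta> x = (1::real)"
    "\<And>x. x \<notin> cball x0 e \<Longrightarrow> \<eta> x = 0" using bump_at[OF e(1)] by blast
  have test: "\<eta> \<in> test_functions U"
    by (rule test_functionsI[of _ "cball x0 e"]) (use \<eta> e in auto)
  have int1: "integrable lborel (\<lambda>x. d * indicator (cball x0 (e/2)) x)"
    using borel_integrable_compact[of "cball x0 (e/2)" "\<lambda>_. d"] by (simp add: mult.commute)
  have int2: "integrable lborel (\<lambda>x. \<eta> x * g x)"
    using test_function_integrable[OF test g] by simp
  have "0 < d * measure lborel (cball x0 (e/2))"
    using d(1) e(1) content_cball_pos[of "e/2" x0] by (simp add: measure_def)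
  also have "\<dots> = (LINT x|lborel. d * indicator (cball x0 (e/2)) x)" by simp
  also have "\<dots> \<le> (LINT x|lborel. \<eta> x * g x * g x0)"
  proof (rule integral_mono[OF int1])
    show "integrable lborel (\<lambda>x. \<eta> x * g x * g x0)" using int2 by simp
    fix x :: "real^2"
    show "d * indicator (cball x0 (e/2)) x \<le> \<eta> x * g x * g x0"
    proof (cases "x \<in> cball x0 e")
      case True
      then have "g x * g x0 > d" by (rule e(3))
      then have "\<eta> x * (g x * g x0) \<ge> \<eta> x * d" using \<eta>(2)[of x] by (intro mult_left_mono) auto
      moreover have "\<eta> x * d \<ge> d * indicator (cball x0 (e/2)) x"
        using \<eta>(2,3)[of x] d(1) by (auto simp: indicator_def)
      ultimately show ?thesis by (simp add: mult.assoc)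
    next
      case False
      then have "x \<notin> cball x0 (e/2)" using e(1) by auto
      then show ?thesis using \<eta>(4)[OF False] by simp
    qed
  qed
  also have "\<dots> = (LINT x|lborel. \<eta> x * g x) * g x0" by simp
  also have "\<dots> = 0" using zero[OF test] by simp
  finally show False by simp
qed

lemma fundamental_lemma:
  fixes g :: "real^2 \<Rightarrow> 'b::euclidean_space"
  assumes U: "open U" and g: "continuous_on U g"
    and zero: "\<And>\<phi>. \<phi> \<in> test_functions U \<Longrightarrow> (LINT x|lborel. \<phi> x *\<^sub>R g x) = 0"
    and x0: "x0 \<in> U"
  shows "g x0 = 0"
proof (rule euclidean_eqI)
  fix b :: 'b assume "b \<in> Basis"
  have "g x0 \<bullet> b = 0"
  proof (rule fundamental_lemma_real[OF U _ _ x0])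
    show "continuous_on U (\<lambda>x. g x \<bullet> b)" using g by (intro continuous_intros)
    fix \<phi> :: "real^2 \<Rightarrow> real" assume \<phi>: "\<phi> \<in> test_functions U"
    have "(LINT x|lborel. (\<phi> x *\<^sub>R g x) \<bullet> b) = (LINT x|lborel. \<phi> x *\<^sub>R g x) \<bullet> b"
      by (rule integral_inner_left) (rule test_function_integrable[OF \<phi> g])
    then show "(LINT x|lborel. \<phi> x * (g x \<bullet> b)) = 0" by (simp add: zero[OF \<phi>])
  qed
  then show "g x0 \<bullet> b = 0 \<bullet> b" by simp
qed


section \<open>Gluing local densities\<close>

lemma represents_on_unique:
  assumes "open U" "open V" "represents_on U f T" "represents_on V g T" "x \<in> U \<inter> V"
  shows "f x = g x"
proof -
  have c: "continuous_on (U \<inter> V) f" "continuous_on (U \<inter> V) g"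
    using assms(3,4) unfolding represents_on_def
    by (auto dest!: smooth_on_continuous intro: continuous_on_subset)
  have "f x - g x = 0"
  proof (rule fundamental_lemma[of "U \<inter> V" "\<lambda>x. f x - g x"])
    fix \<phi> :: "real^2 \<Rightarrow> real" assume \<phi>: "\<phi> \<in> test_functions (U \<inter> V)"
    then have "\<phi> \<in> test_functions U" "\<phi> \<in> test_functions V" by (auto simp: test_functions_def)
    then have "T \<phi> = (LINT x|lborel. \<phi> x *\<^sub>R f x)" "T \<phi> = (LINT x|lborel. \<phi> x *\<^sub>R g x)"
      using assms(3,4) unfolding represents_on_def by blast+
    then show "(LINT x|lborel. \<phi> x *\<^sub>R (f x - g x)) = 0"
      using test_function_integrable[OF \<phi> c(1)] test_function_integrable[OF \<phi> c(2)]
      by (simp add: scaleR_diff_right)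
  qed (use assms c in \<open>auto intro: continuous_on_diff\<close>)
  then show ?thesis by simp
qed

lemma distribution_on_add:
  assumes "distribution_on U T" "\<phi> \<in> test_functions U" "\<psi> \<in> test_functions U"
  shows "T (\<lambda>x. \<phi> x + \<psi> x) = T \<phi> + T \<psi>"
  using assms(1)[unfolded distribution_on_def, THEN conjunct1, rule_format, OF assms(2,3)] .

lemma distribution_on_cmult:
  assumes "distribution_on U T" "\<phi> \<in> test_functions U"
  shows "T (\<lambda>x. c * \<phi> x) = c *\<^sub>R T \<phi>"
  using assms(1)[unfolded distribution_on_def, THEN conjunct2, THEN conjunct1, rule_format, OF assms(2)] .

text \<open>
  Local densities agree on overlaps and define a smooth function \<open>f\<close> on \<open>U\<close>.  That \<open>f\<close> represents \<open>T\<close>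
  globally needs a partition of unity; it is built one ball at a time, by induction on a finite cover
  of the support of \<open>\<phi>\<close>: a bump \<open>\<eta>\<close> that is 1 on one of the balls splits \<open>\<phi>\<close> into \<open>\<phi> \<eta>\<close>, to which the
  local representation applies, and \<open>\<phi> (1 - \<eta>)\<close>, whose support is covered by the remaining balls.
\<close>

lemma represents_on_glue:
  fixes T :: "'b::euclidean_space distr"
  assumes U: "open U" and T: "distribution_on U T"
    and loc: "\<And>x. x \<in> U \<Longrightarrow> \<exists>V f. open V \<and> x \<in> V \<and> V \<subseteq> U \<and> represents_on V f T"
  shows "\<exists>f. represents_on U f T"
proof -
  obtain V F where V: "\<And>x. x \<in> U \<Longrightarrow> open (V x)" "\<And>x. x \<in> U \<Longrightarrow> x \<in> V x" "\<And>x. x \<in> U \<Longrightarrow> V x \<subseteq> U"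
    and F: "\<And>x. x \<in> U \<Longrightarrow> represents_on (V x) (F x) T"
    using loc by metis
  define f where "f x = F x x" for x
  have eq: "f y = F x y" if "x \<in> U" "y \<in> V x" for x y
  proof -
    have "y \<in> U" using V(3) that by blast
    then show ?thesis
      unfolding f_def using represents_on_unique[OF V(1) V(1) F F, of y x y] V(2) that by blast
  qed
  have sm: "smooth_on U f"
  proof (rule smooth_on_local)
    fix x assume x: "x \<in> U"
    have "smooth_on (V x) f"
      by (rule smooth_on_cong[OF V(1)[OF x], of "F x"])
         (use eq[OF x] F[OF x] in \<open>auto simp: represents_on_def\<close>)
    then show "\<exists>V. open V \<and> x \<in> V \<and> smooth_on V f" using V x by blast
  qed
  have local_rep: "T \<phi> = (LINT y|lborel. \<phi> y *\<^sub>R f y)" if x: "x \<in> U" and \<phi>: "\<phi> \<in> test_functions (V x)" for x \<phi>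
  proof -
    have "\<phi> y *\<^sub>R F x y = \<phi> y *\<^sub>R f y" for y
      using eq[OF x, of y] test_functionsD(3)[OF \<phi>] not_in_tsupp[of y \<phi>] by (cases "y \<in> tsupp \<phi>") auto
    moreover have "T \<phi> = (LINT y|lborel. \<phi> y *\<^sub>R F x y)"
      using F[OF x] \<phi> unfolding represents_on_def by blast
    ultimately show ?thesis by (simp only:)
  qed
  obtain e where e: "\<And>x. x \<in> U \<Longrightarrow> e x > 0" "\<And>x. x \<in> U \<Longrightarrow> cball x (e x) \<subseteq> V x"
  proof -
    have "\<forall>x\<in>U. \<exists>d>0. cball x d \<subseteq> V x" using V(1,2) open_contains_cball by blast
    then show ?thesis using that by (metis bchoice)
  qed
  have cover: "T \<phi> = (LINT y|lborel. \<phi> y *\<^sub>R f y)"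
    if "finite C" "C \<subseteq> U" "\<phi> \<in> test_functions U" "tsupp \<phi> \<subseteq> (\<Union>x\<in>C. ball x (e x / 2))" for C \<phi>
    using that
  proof (induction C arbitrary: \<phi> rule: finite_induct)
    case empty
    then have z: "\<phi> = (\<lambda>x. 0)" by (auto intro: not_in_tsupp)
    have "T (\<lambda>x. 0 * \<phi> x) = 0 *\<^sub>R T \<phi>" by (rule distribution_on_cmult[OF T empty(2)])
    then show ?case by (simp add: z)
  next
    case (insert x C)
    then have x: "x \<in> U" by blast
    obtain \<eta> where \<eta>: "smooth_on UNIV \<eta>" "\<And>y. y \<in> cball x (e x / 2) \<Longrightarrow> \<eta> y = (1::real)"
      "\<And>y. y \<notin> cball x (e x) \<Longrightarrow> \<eta> y = 0"
      by (rule bump_at[OF e(1)[OF x], of x]) (rule that, assumption+)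
    let ?\<phi>1 = "\<lambda>y. \<phi> y * \<eta> y" and ?\<phi>2 = "\<lambda>y. \<phi> y * (1 - \<eta> y)"
    have \<phi>1: "?\<phi>1 \<in> test_functions U"
      by (rule test_functions_mult(1)[OF U insert.prems(2)]) (rule smooth_on_subset[OF \<eta>(1)], simp)
    have \<phi>2: "?\<phi>2 \<in> test_functions U"
      by (rule test_functions_mult(1)[OF U insert.prems(2)])
         (rule smooth_on_subset[of UNIV], intro smooth_on_diff smooth_on_const \<eta>, auto)
    have "tsupp ?\<phi>1 \<subseteq> cball x (e x)" by (rule tsupp_subsetI) (auto simp: \<eta>(3))
    then have "?\<phi>1 \<in> test_functions (V x)"
      using e(2)[OF x] by (intro test_functions_mono[OF \<phi>1]) blast
    from local_rep[OF x this] have T1: "T ?\<phi>1 = (LINT y|lborel. ?\<phi>1 y *\<^sub>R f y)" .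
    have T2: "T ?\<phi>2 = (LINT y|lborel. ?\<phi>2 y *\<^sub>R f y)"
    proof (rule insert.IH[OF _ \<phi>2])
      have "tsupp ?\<phi>2 \<subseteq> tsupp \<phi> - ball x (e x / 2)"
        by (rule tsupp_subsetI) (auto simp: \<eta>(2) not_in_tsupp intro: closed_Diff)
      then show "tsupp ?\<phi>2 \<subseteq> (\<Union>x\<in>C. ball x (e x / 2))" using insert.prems(3) by blast
    qed (use insert.prems in blast)
    have "\<phi> = (\<lambda>y. ?\<phi>1 y + ?\<phi>2 y)" by (simp add: algebra_simps)
    then have "T \<phi> = T (\<lambda>y. ?\<phi>1 y + ?\<phi>2 y)" by (rule arg_cong)
    also have "\<dots> = T ?\<phi>1 + T ?\<phi>2" by (rule distribution_on_add[OF T \<phi>1 \<phi>2])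
    also have "\<dots> = (LINT y|lborel. ?\<phi>1 y *\<^sub>R f y) + (LINT y|lborel. ?\<phi>2 y *\<^sub>R f y)"
      unfolding T1 T2 ..
    also have "\<dots> = (LINT y|lborel. ?\<phi>1 y *\<^sub>R f y + ?\<phi>2 y *\<^sub>R f y)"
      by (rule Bochner_Integration.integral_add[symmetric])
         (rule test_function_integrable[OF \<phi>1 smooth_on_continuous[OF sm]]
               test_function_integrable[OF \<phi>2 smooth_on_continuous[OF sm]])+
    also have "(\<lambda>y. ?\<phi>1 y *\<^sub>R f y + ?\<phi>2 y *\<^sub>R f y) = (\<lambda>y. \<phi> y *\<^sub>R f y)"
    proof
      fix y
      have "?\<phi>1 y *\<^sub>R f y + ?\<phi>2 y *\<^sub>R f y = (?\<phi>1 y + ?\<phi>2 y) *\<^sub>R f y" by (rule scaleR_left_distrib[symmetric])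
      then show "?\<phi>1 y *\<^sub>R f y + ?\<phi>2 y *\<^sub>R f y = \<phi> y *\<^sub>R f y" by (simp add: right_diff_distrib)
    qed
    finally show ?case .
  qed
  have "T \<phi> = (LINT y|lborel. \<phi> y *\<^sub>R f y)" if \<phi>: "\<phi> \<in> test_functions U" for \<phi>
  proof -
    have "tsupp \<phi> \<subseteq> (\<Union>x\<in>U. ball x (e x / 2))"
      using test_functionsD(3)[OF \<phi>] e(1) by force
    then obtain C where "C \<subseteq> U" "finite C" "tsupp \<phi> \<subseteq> (\<Union>x\<in>C. ball x (e x / 2))"
      using compactE_image[OF test_functionsD(2)[OF \<phi>], of U "\<lambda>x. ball x (e x / 2)"] by auto
    then show ?thesis using cover[OF _ _ \<phi>] by blast
  qed
  then show ?thesis using sm unfolding represents_on_def by blast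
qed


section \<open>Distributions supported at the origin\<close>

lemma test_functions_word_partial: "\<phi> \<in> test_functions U \<Longrightarrow> word_partial is \<phi> \<in> test_functions U"
  by (induction "is") (auto simp: word_partial_Cons intro: test_functions_partial)

lemma partials_bound_increment:
  fixes f :: "real^2 \<Rightarrow> real"
  assumes f: "smooth_on UNIV f" and S: "convex S"
    and B: "\<And>i x. x \<in> S \<Longrightarrow> \<bar>partial i f x\<bar> \<le> B i" and xy: "x \<in> S" "y \<in> S"
  shows "\<bar>f x - f y\<bar> \<le> (\<Sum>i\<in>UNIV. B i) * norm (x - y)"
proof -
  have "norm (f x - f y) \<le> (\<Sum>i\<in>UNIV. B i) * norm (x - y)"
  proof (rule differentiable_bound[OF S _ _ xy])
    fix z assume z: "z \<in> S"
    have "(f has_derivative (\<lambda>h. \<Sum>i\<in>UNIV. h $ i *\<^sub>R partial i f z)) (at z)"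
      by (rule has_derivative_partials) (use smooth_on_differentiable[OF f] in simp)
    then show "(f has_derivative (\<lambda>h. \<Sum>i\<in>UNIV. h $ i *\<^sub>R partial i f z)) (at z within S)"
      by (rule has_derivative_at_withinI)
    show "onorm (\<lambda>h::real^2. \<Sum>i\<in>UNIV. h $ i *\<^sub>R partial i f z) \<le> (\<Sum>i\<in>UNIV. B i)"
    proof (rule onorm_le)
      fix h :: "real^2"
      have "norm (\<Sum>i\<in>UNIV. h $ i *\<^sub>R partial i f z) \<le> (\<Sum>i\<in>UNIV. norm h * B i)"
      proof (rule sum_norm_le)
        fix i :: 2
        have "\<bar>h $ i\<bar> * \<bar>partial i f z\<bar> \<le> norm h * B i"
          by (rule mult_mono) (use component_le_norm_cart[of h i] B[OF z] in auto)
        then show "norm (h $ i *\<^sub>R partial i f z) \<le> norm h * B i" by (simp add: abs_mult)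
      qed
      then show "norm (\<Sum>i\<in>UNIV. h $ i *\<^sub>R partial i f z) \<le> (\<Sum>i\<in>UNIV. B i) * norm h"
        by (simp add: sum_distrib_left mult.commute)
    qed
  qed
  then show ?thesis by simp
qed

text \<open>
  Taylor's estimate, by induction on the order: the partials vanish at 0 to one order less, and the
  mean value inequality on the ball of radius \<open>e\<close> gains one factor \<open>e\<close>.
\<close>

lemma vanishing_jet_bound:
  assumes "smooth_on UNIV \<phi>" "\<And>is. length is < n \<Longrightarrow> word_partial is \<phi> 0 = 0"
  shows "\<exists>C. \<forall>e\<in>{0<..1}. \<forall>x\<in>cball 0 e. \<bar>\<phi> x\<bar> \<le> C * e ^ n"
  using assms
proof (induction n arbitrary: \<phi>)
  case 0
  have "compact (\<phi> ` cball 0 1)"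
    using smooth_on_continuous[OF 0(1)] by (intro compact_continuous_image) (auto intro: continuous_on_subset)
  then obtain C where "\<forall>y\<in>\<phi> ` cball 0 1. \<bar>y\<bar> \<le> C" using compact_imp_bounded bounded_real by metis
  then show ?case by (intro exI[of _ C]) auto
next
  case (Suc n)
  have "\<exists>C. \<forall>e\<in>{0<..1}. \<forall>x\<in>cball 0 e. \<bar>partial i \<phi> x\<bar> \<le> C * e ^ n" for i
  proof (rule Suc.IH)
    show "smooth_on UNIV (partial i \<phi>)" by (rule smooth_on_partial[OF Suc.prems(1)])
    show "word_partial is (partial i \<phi>) 0 = 0" if "length is < n" for "is"
      using Suc.prems(2)[of "is @ [i]"] that by (simp add: word_partial_snoc)
  qed
  then obtain C where C: "\<And>i e x. e \<in> {0<..1} \<Longrightarrow> x \<in> cball 0 e \<Longrightarrow> \<bar>partial i \<phi> x\<bar> \<le> C i * e ^ n"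
    by metis
  have "\<bar>\<phi> x\<bar> \<le> (\<Sum>i\<in>UNIV. C i) * e ^ Suc n" if e: "e \<in> {0<..1}" and x: "x \<in> cball 0 e" for e x
  proof -
    have "\<bar>\<phi> x - \<phi> 0\<bar> \<le> (\<Sum>i\<in>UNIV. C i * e ^ n) * norm (x - 0)"
      by (rule partials_bound_increment[OF Suc.prems(1), of "cball 0 e"]) (use C e x in auto)
    moreover have "(\<Sum>i\<in>UNIV. C i * e ^ n) * norm (x - 0) \<le> (\<Sum>i\<in>UNIV. C i * e ^ n) * e"
    proof (rule mult_left_mono)
      have "0 \<le> C i * e ^ n" for i using C[OF e, of 0 i] e by auto
      then show "0 \<le> (\<Sum>i\<in>UNIV. C i * e ^ n)" by (intro sum_nonneg)
    qed (use x in auto)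
    moreover have "\<phi> 0 = 0" using Suc.prems(2)[of "[]"] by simp
    ultimately show ?thesis by (simp add: sum_distrib_right[symmetric] mult_ac)
  qed
  then show ?case by blast
qed

text \<open>
  A word \<open>is\<close> of partials of \<open>F e\<close> is of size \<open>e\<close> to the power \<open>m - j - \<bar>is\<bar>\<close> on the ball of radius \<open>e\<close>,
  uniformly in \<open>0 < e \<le> 1\<close>, for all words up to length \<open>n\<close>.  The possibly negative exponent is moved to
  the left.  The parameter \<open>j\<close> counts derivatives that were taken before; it makes the class stable
  under partial derivatives, and then products follow by induction on \<open>n\<close> without the Leibniz formula
  for iterated partials.
\<close>

definition rescaling_bound :: "nat \<Rightarrow> nat \<Rightarrow> nat \<Rightarrow> (real \<Rightarrow> real^2 \<Rightarrow> real) \<Rightarrow> bool" where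
  "rescaling_bound n j m F \<longleftrightarrow> (\<forall>is. length is \<le> n \<longrightarrow>
     (\<exists>C. \<forall>e\<in>{0<..1}. \<forall>x\<in>cball 0 e. \<bar>word_partial is (F e) x\<bar> * e ^ (length is + j) \<le> C * e ^ m))"

lemma rescaling_bound_partial:
  "rescaling_bound (Suc n) j m F \<Longrightarrow> rescaling_bound n (Suc j) m (\<lambda>e. partial i (F e))"
  unfolding rescaling_bound_def
proof (intro allI impI)
  fix "is" :: "2 list"
  assume *: "\<forall>is. length is \<le> Suc n \<longrightarrow>
     (\<exists>C. \<forall>e\<in>{0<..1}. \<forall>x\<in>cball 0 e. \<bar>word_partial is (F e) x\<bar> * e ^ (length is + j) \<le> C * e ^ m)"
    and "length is \<le> n"
  then show "\<exists>C. \<forall>e\<in>{0<..1}. \<forall>x\<in>cball 0 e. \<bar>word_partial is (partial i (F e)) x\<bar> * e ^ (length is + Suc j) \<le> C * e ^ m"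
    using *[rule_format, of "is @ [i]"] by (simp add: word_partial_snoc)
qed

lemma rescaling_bound_mono: "rescaling_bound n j m F \<Longrightarrow> n' \<le> n \<Longrightarrow> rescaling_bound n' j m F"
  unfolding rescaling_bound_def by auto

lemma rescaling_bound_mult:
  assumes "\<And>e. smooth_on UNIV (F e)" "\<And>e. smooth_on UNIV (G e)"
    "rescaling_bound n j k F" "rescaling_bound n l m G"
  shows "rescaling_bound n (j + l) (k + m) (\<lambda>e x. F e x * G e x)"
  using assms
proof (induction n arbitrary: F G j l)
  case 0
  have "\<exists>C. \<forall>e\<in>{0<..1}. \<forall>x\<in>cball 0 e. \<bar>F e x\<bar> * e ^ j \<le> C * e ^ k"
    using 0(3)[unfolded rescaling_bound_def, rule_format, of "[]"] by simp
  then obtain C where C: "\<forall>e\<in>{0<..1}. \<forall>x\<in>cball 0 e. \<bar>F e x\<bar> * e ^ j \<le> C * e ^ k" ..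
  have "\<exists>D. \<forall>e\<in>{0<..1}. \<forall>x\<in>cball 0 e. \<bar>G e x\<bar> * e ^ l \<le> D * e ^ m"
    using 0(4)[unfolded rescaling_bound_def, rule_format, of "[]"] by simp
  then obtain D where D: "\<forall>e\<in>{0<..1}. \<forall>x\<in>cball 0 e. \<bar>G e x\<bar> * e ^ l \<le> D * e ^ m" ..
  have "\<bar>F e x * G e x\<bar> * e ^ (j + l) \<le> (C * D) * e ^ (k + m)" if e: "e \<in> {0<..1}" and x: "x \<in> cball 0 e" for e x
  proof -
    have "0 \<le> \<bar>F e x\<bar> * e ^ j" "0 \<le> \<bar>G e x\<bar> * e ^ l" using e by auto
    then have "(\<bar>F e x\<bar> * e ^ j) * (\<bar>G e x\<bar> * e ^ l) \<le> (C * e ^ k) * (D * e ^ m)"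
      using C[rule_format, OF e x] D[rule_format, OF e x] by (intro mult_mono[of "\<bar>F e x\<bar> * e ^ j"]) linarith+
    then show ?thesis by (simp add: abs_mult power_add mult_ac)
  qed
  then have "\<exists>C. \<forall>e\<in>{0<..1}. \<forall>x\<in>cball 0 e. \<bar>F e x * G e x\<bar> * e ^ (j + l) \<le> C * e ^ (k + m)" by blast
  then show ?case unfolding rescaling_bound_def by simp
next
  case (Suc n)
  have d: "f differentiable (at x)" if "smooth_on UNIV f" for f :: "real^2 \<Rightarrow> real" and x
    using smooth_on_differentiable[OF that] by simp
  have part: "partial i (\<lambda>x. F e x * G e x) = (\<lambda>x. partial i (F e) x * G e x + F e x * partial i (G e) x)" for i e
    by (rule ext, rule partial_bilinear[OF bounded_bilinear_mult]) (intro d Suc.prems)+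
  have low: "rescaling_bound n j k F" "rescaling_bound n l m G" using Suc.prems rescaling_bound_mono by (metis le_SucI order_refl)+
  show ?case
    unfolding rescaling_bound_def
  proof (intro allI impI)
    fix js :: "2 list" assume js: "length js \<le> Suc n"
    show "\<exists>C. \<forall>e\<in>{0<..1}. \<forall>x\<in>cball 0 e.
        \<bar>word_partial js (\<lambda>x. F e x * G e x) x\<bar> * e ^ (length js + (j + l)) \<le> C * e ^ (k + m)"
    proof (cases js rule: rev_exhaust)
      case Nil
      then show ?thesis
        using Suc.IH[OF Suc.prems(1,2) low] unfolding rescaling_bound_def by (metis le0 list.size(3))
    next
      case (snoc "is" i)
      then have len: "length is \<le> n" using js by simp
      obtain C where C: "\<And>e x. e \<in> {0<..1} \<Longrightarrow> x \<in> cball 0 e \<Longrightarrow>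
          \<bar>word_partial is (\<lambda>x. partial i (F e) x * G e x) x\<bar> * e ^ (length is + (Suc j + l)) \<le> C * e ^ (k + m)"
        using Suc.IH[of "\<lambda>e. partial i (F e)" G "Suc j" l, OF smooth_on_partial[OF Suc.prems(1)] Suc.prems(2)
            rescaling_bound_partial[OF Suc.prems(3)] low(2)] len unfolding rescaling_bound_def by meson
      obtain D where D: "\<And>e x. e \<in> {0<..1} \<Longrightarrow> x \<in> cball 0 e \<Longrightarrow>
          \<bar>word_partial is (\<lambda>x. F e x * partial i (G e) x) x\<bar> * e ^ (length is + (j + Suc l)) \<le> D * e ^ (k + m)"
        using Suc.IH[of F "\<lambda>e. partial i (G e)" j "Suc l", OF Suc.prems(1) smooth_on_partial[OF Suc.prems(2)]
            low(1) rescaling_bound_partial[OF Suc.prems(4)]] len unfolding rescaling_bound_def by meson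
      have "\<bar>word_partial js (\<lambda>x. F e x * G e x) x\<bar> * e ^ (length js + (j + l)) \<le> (C + D) * e ^ (k + m)"
        if e: "e \<in> {0<..1}" and x: "x \<in> cball 0 e" for e x
      proof -
        let ?A = "word_partial is (\<lambda>x. partial i (F e) x * G e x) x" and ?B = "word_partial is (\<lambda>x. F e x * partial i (G e) x) x"
        have "word_partial js (\<lambda>x. F e x * G e x) x = ?A + ?B"
          unfolding snoc word_partial_snoc part
          by (subst word_partial_add) (auto intro: smooth_on_mult smooth_on_partial Suc.prems)
        then have "\<bar>word_partial js (\<lambda>x. F e x * G e x) x\<bar> * e ^ (length js + (j + l))
            \<le> (\<bar>?A\<bar> + \<bar>?B\<bar>) * e ^ (length js + (j + l))"
          using e by (intro mult_right_mono) auto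
        also have "\<dots> \<le> (C + D) * e ^ (k + m)"
          using C[OF e x] D[OF e x] by (simp add: snoc distrib_right)
        finally show ?thesis .
      qed
      then show ?thesis by blast
    qed
  qed
qed

text \<open>
  Let \<open>\<eta>\<^sub>e\<close> be a cutoff of radius \<open>e\<close> that is 1 near the origin.  Then \<open>\<phi> (1 - \<eta>\<^sub>e)\<close> is supported off the
  origin, so \<open>S \<phi> = S (\<phi> \<eta>\<^sub>e)\<close>.  On the ball of radius \<open>e\<close> the function \<open>\<phi>\<close> is \<open>O(e ^ (N + 1))\<close> and the
  cutoff is bounded; each derivative of either factor costs one power of \<open>e\<close>, so the derivatives of
  the product up to order \<open>N\<close> are all \<open>O(e)\<close>, and so is \<open>S (\<phi> \<eta>\<^sub>e)\<close>.
\<close>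

lemma point_supported_vanishes:
  fixes S :: "real distr"
  assumes U: "open U" and s: "s > 0" "cball 0 s \<subseteq> U"
    and add: "\<And>\<phi> \<psi>. \<phi> \<in> test_functions U \<Longrightarrow> \<psi> \<in> test_functions U \<Longrightarrow> S (\<lambda>x. \<phi> x + \<psi> x) = S \<phi> + S \<psi>"
    and supp: "\<And>\<phi>. \<phi> \<in> test_functions (U - {0}) \<Longrightarrow> S \<phi> = 0"
    and bound: "\<And>\<phi> M. \<phi> \<in> test_functions U \<Longrightarrow> tsupp \<phi> \<subseteq> cball 0 s \<Longrightarrow>
        (\<And>is x. length is \<le> N \<Longrightarrow> \<bar>word_partial is \<phi> x\<bar> \<le> M) \<Longrightarrow> \<bar>S \<phi>\<bar> \<le> C * M"
    and \<phi>: "\<phi> \<in> test_functions U"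
    and jet: "\<And>is. length is \<le> N \<Longrightarrow> word_partial is \<phi> 0 = 0"
  shows "S \<phi> = 0"
proof -
  note sm = test_functionsD(1)[OF \<phi>]
  obtain \<eta> :: "real^2 \<Rightarrow> real" where \<eta>: "smooth_on UNIV \<eta>"
      "\<And>x. x \<in> cball 0 (1/2) \<Longrightarrow> \<eta> x = 1" "\<And>x. x \<notin> cball 0 1 \<Longrightarrow> \<eta> x = 0"
    by (rule bump_at[of 1 0]) (simp, rule that, assumption+)
  have \<eta>test: "\<eta> \<in> test_functions UNIV" by (rule test_functionsI[of _ "cball 0 1"]) (use \<eta> in auto)
  define \<eta>\<^sub>e where "\<eta>\<^sub>e e x = \<eta> ((1/e) *\<^sub>R x)" for e x
  have sm_\<eta>: "smooth_on UNIV (\<eta>\<^sub>e e)" for e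
    using smooth_affine[OF \<eta>(1), of 0 "1/e"] by (simp add: \<eta>\<^sub>e_def[abs_def])
  have \<eta>_in: "\<eta>\<^sub>e e x = 1" if "e > 0" "x \<in> ball 0 (e/2)" for e x
    unfolding \<eta>\<^sub>e_def by (rule \<eta>(2)) (use that in \<open>simp add: field_simps\<close>)
  have \<eta>_out: "\<eta>\<^sub>e e x = 0" if "e > 0" "x \<notin> cball 0 e" for e x
    unfolding \<eta>\<^sub>e_def by (rule \<eta>(3)) (use that in \<open>simp add: field_simps\<close>)
  have bF: "rescaling_bound N 0 (Suc N) (\<lambda>e. \<phi>)"
    unfolding rescaling_bound_def
  proof (intro allI impI)
    fix "is" :: "2 list" assume len: "length is \<le> N"
    have "\<exists>C. \<forall>e\<in>{0<..1}. \<forall>x\<in>cball 0 e. \<bar>word_partial is \<phi> x\<bar> \<le> C * e ^ (Suc N - length is)"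
    proof (rule vanishing_jet_bound[OF smooth_word_partial[OF sm]])
      fix js :: "2 list" assume "length js < Suc N - length is"
      then show "word_partial js (word_partial is \<phi>) 0 = 0" using jet[of "js @ is"] by (simp add: word_partial_append)
    qed
    then obtain C where C: "\<And>e x. e \<in> {0<..1} \<Longrightarrow> x \<in> cball 0 e \<Longrightarrow> \<bar>word_partial is \<phi> x\<bar> \<le> C * e ^ (Suc N - length is)"
      by blast
    have "\<bar>word_partial is \<phi> x\<bar> * e ^ (length is + 0) \<le> C * e ^ Suc N" if e: "e \<in> {0<..1}" and x: "x \<in> cball 0 e" for e x
    proof -
      have "\<bar>word_partial is \<phi> x\<bar> * e ^ length is \<le> C * e ^ (Suc N - length is) * e ^ length is"
        using C[OF e x] e by (intro mult_right_mono) auto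
      also have "\<dots> = C * e ^ Suc N" using len by (simp add: mult.assoc power_add[symmetric] del: power_Suc)
      finally show ?thesis by simp
    qed
    then show "\<exists>C. \<forall>e\<in>{0<..1}. \<forall>x\<in>cball 0 e. \<bar>word_partial is \<phi> x\<bar> * e ^ (length is + 0) \<le> C * e ^ Suc N" by blast
  qed
  have bG: "rescaling_bound N 0 0 \<eta>\<^sub>e"
    unfolding rescaling_bound_def
  proof (intro allI impI)
    fix "is" :: "2 list"
    obtain M where M: "\<And>x. \<bar>word_partial is \<eta> x\<bar> \<le> M"
      using test_function_bounded[OF test_functions_word_partial[OF \<eta>test]] by blast
    have "\<bar>word_partial is (\<eta>\<^sub>e e) x\<bar> * e ^ (length is + 0) \<le> M * e ^ 0" if e: "e \<in> {0<..1}" for e x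
    proof -
      have "word_partial is (\<eta>\<^sub>e e) x = (1/e) ^ length is * word_partial is \<eta> ((1/e) *\<^sub>R x)"
        using word_partial_affine[OF \<eta>(1), of "is" 0 "1/e"] by (simp add: \<eta>\<^sub>e_def[abs_def])
      then have "\<bar>word_partial is (\<eta>\<^sub>e e) x\<bar> * e ^ length is = \<bar>word_partial is \<eta> ((1/e) *\<^sub>R x)\<bar>"
        using e by (simp add: abs_mult power_divide)
      then show ?thesis using M by simp
    qed
    then show "\<exists>C. \<forall>e\<in>{0<..1}. \<forall>x\<in>cball 0 e. \<bar>word_partial is (\<eta>\<^sub>e e) x\<bar> * e ^ (length is + 0) \<le> C * e ^ 0" by blast
  qed
  let ?\<psi> = "\<lambda>e x. \<phi> x * \<eta>\<^sub>e e x"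
  have "rescaling_bound N (0 + 0) (Suc N + 0) ?\<psi>"
    by (rule rescaling_bound_mult[OF sm sm_\<eta> bF bG])
  then have "\<forall>is. \<exists>C. length is \<le> N \<longrightarrow> (\<forall>e\<in>{0<..1}. \<forall>x\<in>cball 0 e. \<bar>word_partial is (?\<psi> e) x\<bar> * e ^ length is \<le> C * e ^ Suc N)"
    unfolding rescaling_bound_def by auto
  then obtain B where B: "\<And>is e x. length is \<le> N \<Longrightarrow> e \<in> {0<..1} \<Longrightarrow> x \<in> cball 0 e \<Longrightarrow>
      \<bar>word_partial is (?\<psi> e) x\<bar> * e ^ length is \<le> B is * e ^ Suc N"
    unfolding choice_iff by blast
  define D where "D = (\<Sum>is | length is \<le> N. \<bar>B is\<bar>)"
  have fin: "finite {is :: 2 list. length is \<le> N}"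
    using finite_lists_length_le[of "UNIV :: 2 set" N] by simp
  have small: "\<bar>word_partial is (?\<psi> e) x\<bar> \<le> D * e" if len: "length is \<le> N" and e: "e \<in> {0<..1}" for "is" e x
  proof (cases "x \<in> cball 0 e")
    case True
    have e0: "e > 0" "e \<le> 1" using e by auto
    have "\<bar>word_partial is (?\<psi> e) x\<bar> * e ^ N \<le> \<bar>word_partial is (?\<psi> e) x\<bar> * e ^ length is"
      using e0 len by (intro mult_left_mono power_decreasing) auto
    also have "\<dots> \<le> B is * e ^ Suc N" by (rule B[OF len e True])
    also have "\<dots> = (B is * e) * e ^ N" by simp
    finally have "\<bar>word_partial is (?\<psi> e) x\<bar> \<le> B is * e" using e0 by simp
    also have "\<dots> \<le> D * e"
    proof (rule mult_right_mono)
      have "B is \<le> \<bar>B is\<bar>" by simp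
      also have "\<dots> \<le> D" unfolding D_def using fin len by (intro member_le_sum) auto
      finally show "B is \<le> D" .
    qed (use e0 in simp)
    finally show ?thesis .
  next
    case False
    have "word_partial is (?\<psi> e) x = word_partial is (\<lambda>x. 0) x"
      by (rule word_partial_cong_open[of "- cball 0 e"]) (use False \<eta>_out e in auto)
    also have "\<dots> = 0" using word_partial_cmult[of "\<lambda>x. 0" "is" 0] by simp
    finally show ?thesis using e by (auto simp: D_def intro!: sum_nonneg)
  qed
  have est: "\<bar>S \<phi>\<bar> \<le> C * (D * e)" if e: "e \<in> {0<..1}" "e \<le> s" for e
  proof -
    have e0: "e > 0" using e by simp
    let ?\<rho> = "\<lambda>x. \<phi> x * (1 - \<eta>\<^sub>e e x)"
    have \<psi>: "?\<psi> e \<in> test_functions U"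
      by (rule test_functions_mult(1)[OF U \<phi>]) (rule smooth_on_subset[OF sm_\<eta>], simp)
    have \<rho>: "?\<rho> \<in> test_functions U"
      by (rule test_functions_mult(1)[OF U \<phi>])
         (rule smooth_on_subset[of UNIV], intro smooth_on_diff smooth_on_const sm_\<eta>, auto)
    have "tsupp ?\<rho> \<subseteq> tsupp \<phi> - ball 0 (e/2)"
      by (rule tsupp_subsetI) (use \<eta>_in[OF e0] in \<open>auto simp: not_in_tsupp intro: closed_Diff\<close>)
    then have "?\<rho> \<in> test_functions (U - {0})"
      using test_functionsD(3)[OF \<phi>] e0 by (intro test_functions_mono[OF \<rho>]) auto
    then have "S ?\<rho> = 0" by (rule supp)
    moreover have "S (\<lambda>x. ?\<psi> e x + ?\<rho> x) = S (?\<psi> e) + S ?\<rho>" by (rule add[OF \<psi> \<rho>])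
    moreover have "(\<lambda>x. ?\<psi> e x + ?\<rho> x) = \<phi>" by (simp add: algebra_simps)
    moreover have "\<bar>S (?\<psi> e)\<bar> \<le> C * (D * e)"
    proof (rule bound[OF \<psi>])
      have "tsupp (?\<psi> e) \<subseteq> cball 0 e" by (rule tsupp_subsetI) (use \<eta>_out[OF e0] in auto)
      then show "tsupp (?\<psi> e) \<subseteq> cball 0 s" using e by force
    qed (rule small[OF _ e(1)])
    ultimately show ?thesis by simp
  qed
  have "((\<lambda>e. C * (D * e)) \<longlongrightarrow> C * (D * 0)) (at_right 0)" by (intro tendsto_intros)
  moreover have "\<forall>\<^sub>F e in at_right 0. \<bar>S \<phi>\<bar> \<le> C * (D * e)"
    using s by (intro eventually_at_rightI[of 0 "min 1 s"] est) auto
  ultimately have "\<bar>S \<phi>\<bar> \<le> C * (D * 0)"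
    by (intro tendsto_lowerbound[of "\<lambda>e. C * (D * e)" _ "at_right 0"]) auto
  then show ?thesis by simp
qed

text \<open>
  The continuity estimate in the form that is convenient here: a common bound for all derivatives up
  to the order of the distribution on \<open>K\<close> replaces the sum of suprema.
\<close>

lemma distribution_word_partial_bound:
  fixes T :: "'b::real_normed_vector distr"
  assumes T: "distribution_on U T" and K: "compact K" "K \<subseteq> U"
  obtains C N where "\<forall>\<phi>\<in>test_functions U. \<forall>M. tsupp \<phi> \<subseteq> K \<longrightarrow>
        (\<forall>is x. length is \<le> N \<longrightarrow> \<bar>word_partial is \<phi> x\<bar> \<le> M) \<longrightarrow> norm (T \<phi>) \<le> C * M"
proof -
  obtain C N where CN: "\<And>\<phi>. \<phi> \<in> test_functions U \<Longrightarrow> tsupp \<phi> \<subseteq> K \<Longrightarrow>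
      norm (T \<phi>) \<le> C * (\<Sum>\<alpha>\<in>{\<alpha>. mlen \<alpha> \<le> N}. SUP x. \<bar>mpartial \<alpha> \<phi> x\<bar>)"
    using T K unfolding distribution_on_def by meson
  let ?A = "{\<alpha>. mlen \<alpha> \<le> N}"
  show ?thesis
  proof (rule that[of N "\<bar>C\<bar> * card ?A"], intro ballI allI impI)
    fix \<phi> M assume \<phi>: "\<phi> \<in> test_functions U" "tsupp \<phi> \<subseteq> K"
      and M: "\<forall>is x. length is \<le> N \<longrightarrow> \<bar>word_partial is \<phi> x\<bar> \<le> M"
    have sup: "\<bar>SUP x. \<bar>mpartial \<alpha> \<phi> x\<bar>\<bar> \<le> M" if "\<alpha> \<in> ?A" for \<alpha>
    proof -
      have m: "\<bar>mpartial \<alpha> \<phi> x\<bar> \<le> M" for x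
        unfolding mpartial_eq_word_partial by (rule M[rule_format]) (use that in \<open>simp add: mlen_def\<close>)
      then have bdd: "bdd_above (range (\<lambda>x. \<bar>mpartial \<alpha> \<phi> x\<bar>))" by (intro bdd_aboveI[of _ M]) auto
      have "(SUP x. \<bar>mpartial \<alpha> \<phi> x\<bar>) \<le> M" by (rule cSUP_least) (use m in auto)
      moreover have "0 \<le> (SUP x. \<bar>mpartial \<alpha> \<phi> x\<bar>)"
        by (rule cSUP_upper2[OF bdd, of 0]) auto
      ultimately show ?thesis by simp
    qed
    have "norm (T \<phi>) \<le> C * (\<Sum>\<alpha>\<in>?A. SUP x. \<bar>mpartial \<alpha> \<phi> x\<bar>)" by (rule CN[OF \<phi>])
    also have "\<dots> \<le> \<bar>C * (\<Sum>\<alpha>\<in>?A. SUP x. \<bar>mpartial \<alpha> \<phi> x\<bar>)\<bar>" by simp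
    also have "\<dots> \<le> \<bar>C\<bar> * (\<Sum>\<alpha>\<in>?A. \<bar>SUP x. \<bar>mpartial \<alpha> \<phi> x\<bar>\<bar>)"
      unfolding abs_mult by (intro mult_left_mono sum_abs) simp
    also have "\<dots> \<le> \<bar>C\<bar> * (\<Sum>\<alpha>\<in>?A. M)" by (intro mult_left_mono sum_mono sup) simp_all
    finally show "norm (T \<phi>) \<le> \<bar>C\<bar> * card ?A * M" by (simp add: mult.assoc)
  qed
qed


section \<open>The incompatibility distribution of a singular strain field\<close>

lemma sing_sym_fieldsD:
  assumes "E \<in> sing_sym_fields U"
  shows "distribution_on U E" "\<phi> \<in> test_functions U \<Longrightarrow> E \<phi> $ 1 $ 2 = E \<phi> $ 2 $ 1" "sing_supp U E \<subseteq> {0}"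
proof -
  show "distribution_on U E" "sing_supp U E \<subseteq> {0}" using assms by (auto simp: sing_sym_fields_def)
  assume "\<phi> \<in> test_functions U"
  then have "transpose (E \<phi>) $ 1 $ 2 = E \<phi> $ 1 $ 2" using assms by (simp add: sing_sym_fields_def Sym_def)
  then show "E \<phi> $ 1 $ 2 = E \<phi> $ 2 $ 1" by (simp add: transpose_def)
qed

text \<open>
  The two expressions have the mixed partials of \<open>\<phi>\<close> in opposite order; the symmetry of the values of
  \<open>E\<close> compensates for this.
\<close>

lemma Curl_Curl_eq_tensor_action:
  assumes E: "E \<in> sing_sym_fields U" and \<phi>: "\<phi> \<in> test_functions U"
  shows "Curl_vec (Curl_ten E) \<phi> = tensor_action E (\<lambda>x. A_map (hessian \<phi> x))"
proof -
  have neg: "E (\<lambda>x. - \<psi> x) = - E \<psi>" if "\<psi> \<in> test_functions U" for \<psi>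
    using distribution_on_cmult[OF sing_sym_fieldsD(1)[OF E] that, of "-1"] by simp
  have t: "partial i (partial j \<phi>) \<in> test_functions U" for i j
    by (intro test_functions_partial \<phi>)
  show ?thesis
    unfolding tensor_action_def sum_2 A_map_components Curl_vec_Curl_ten
    by (simp add: hessian_def neg[OF t] sing_sym_fieldsD(2)[OF E t])
qed

lemma Curl_Curl_add:
  assumes E: "distribution_on U E" and "\<phi> \<in> test_functions U" "\<psi> \<in> test_functions U"
  shows "Curl_vec (Curl_ten E) (\<lambda>x. \<phi> x + \<psi> x) = Curl_vec (Curl_ten E) \<phi> + Curl_vec (Curl_ten E) \<psi>"
proof -
  have "partial i (partial j (\<lambda>x. \<phi> x + \<psi> x)) = (\<lambda>x. partial i (partial j \<phi>) x + partial i (partial j \<psi>) x)" for i j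
    using word_partial_add[OF test_functionsD(1)[OF assms(2)] test_functionsD(1)[OF assms(3)], of "[i, j]"]
    by (simp add: word_partial_Cons)
  moreover have "E (\<lambda>x. partial i (partial j \<phi>) x + partial i (partial j \<psi>) x) =
      E (partial i (partial j \<phi>)) + E (partial i (partial j \<psi>))" for i j
    by (rule distribution_on_add[OF E]) (intro test_functions_partial assms)+
  ultimately show ?thesis by (simp add: Curl_vec_Curl_ten)
qed

lemma Curl_Curl_cmult:
  assumes E: "distribution_on U E" and "\<phi> \<in> test_functions U"
  shows "Curl_vec (Curl_ten E) (\<lambda>x. c * \<phi> x) = c * Curl_vec (Curl_ten E) \<phi>"
proof -
  have "partial i (partial j (\<lambda>x. c * \<phi> x)) = (\<lambda>x. c * partial i (partial j \<phi>) x)" for i j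
    using word_partial_cmult[OF test_functionsD(1)[OF assms(2)], of "[i, j]" c]
    by (simp add: word_partial_Cons)
  moreover have "E (\<lambda>x. c * partial i (partial j \<phi>) x) = c *\<^sub>R E (partial i (partial j \<phi>))" for i j
    by (rule distribution_on_cmult[OF E]) (intro test_functions_partial assms)
  ultimately show ?thesis by (simp add: Curl_vec_Curl_ten algebra_simps)
qed

lemma Curl_Curl_sum:
  assumes E: "distribution_on U E" and "finite A" "\<And>a. a \<in> A \<Longrightarrow> \<phi> a \<in> test_functions U"
  shows "Curl_vec (Curl_ten E) (\<lambda>x. \<Sum>a\<in>A. \<phi> a x) = (\<Sum>a\<in>A. Curl_vec (Curl_ten E) (\<phi> a))"
  using assms(2,3)
proof (induction A rule: finite_induct)
  case empty
  then show ?case using Curl_Curl_cmult[OF E test_functions_zero, of 0] by simp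
next
  case (insert a A)
  then show ?case by (simp add: Curl_Curl_add[OF E] test_functions_sum)
qed

lemma Curl_Curl_word_partial_bound:
  assumes E: "distribution_on U E" and K: "compact K" "K \<subseteq> U"
  obtains C N where "\<forall>\<phi>\<in>test_functions U. \<forall>M. tsupp \<phi> \<subseteq> K \<longrightarrow>
        (\<forall>is x. length is \<le> N \<longrightarrow> \<bar>word_partial is \<phi> x\<bar> \<le> M) \<longrightarrow> \<bar>Curl_vec (Curl_ten E) \<phi>\<bar> \<le> C * M"
proof -
  obtain C N where CN: "\<forall>\<phi>\<in>test_functions U. \<forall>M. tsupp \<phi> \<subseteq> K \<longrightarrow>
        (\<forall>is x. length is \<le> N \<longrightarrow> \<bar>word_partial is \<phi> x\<bar> \<le> M) \<longrightarrow> norm (E \<phi>) \<le> C * M"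
    by (rule distribution_word_partial_bound[OF E K]) (rule that)
  show ?thesis
  proof (rule that[of "N + 2" "4 * C"], intro ballI allI impI)
    fix \<phi> M assume \<phi>: "\<phi> \<in> test_functions U" "tsupp \<phi> \<subseteq> K"
      and M: "\<forall>is x. length is \<le> N + 2 \<longrightarrow> \<bar>word_partial is \<phi> x\<bar> \<le> M"
    have "\<bar>E (partial i (partial j \<phi>)) $ k $ l\<bar> \<le> C * M" for i j k l
    proof -
      have "\<bar>E (partial i (partial j \<phi>)) $ k $ l\<bar> \<le> norm (E (partial i (partial j \<phi>)))"
        using component_le_norm_cart[of "E (partial i (partial j \<phi>)) $ k" l]
          Finite_Cartesian_Product.norm_nth_le[of "E (partial i (partial j \<phi>))" k] by linarith
      also have "\<dots> \<le> C * M"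
      proof (rule CN[rule_format])
        show "tsupp (partial i (partial j \<phi>)) \<subseteq> K"
          using tsupp_partial[of i "partial j \<phi>"] tsupp_partial[of j \<phi>] \<phi>(2) by blast
        show "\<bar>word_partial is (partial i (partial j \<phi>)) x\<bar> \<le> M" if "length is \<le> N" for "is" x
          using M[rule_format, of "is @ [i, j]" x] that by (simp add: word_partial_append word_partial_Cons)
      qed (intro test_functions_partial \<phi>)
      finally show ?thesis .
    qed
    from this[of 1 1 2 2] this[of 2 1 2 1] this[of 1 2 1 2] this[of 2 2 1 1]
    show "\<bar>Curl_vec (Curl_ten E) \<phi>\<bar> \<le> 4 * C * M" unfolding Curl_vec_Curl_ten by linarith
  qed
qed

text \<open>
  The definition of singular support provides densities near each point of the punctured domain only;
  gluing them shows that the global density chosen by \<^const>\<open>smooth_density\<close> exists.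
\<close>

lemma smooth_density_represents:
  assumes U: "open U" and E: "distribution_on U E" "sing_supp U E \<subseteq> {0}"
  shows "represents_on (U - {0}) (smooth_density (U - {0}) E) E"
proof -
  have "\<exists>f. represents_on (U - {0}) f E"
  proof (rule represents_on_glue)
    show "open (U - {0})" using U by (rule open_delete)
    show "distribution_on (U - {0}) E"
    proof -
      have sub: "\<phi> \<in> test_functions U" if "\<phi> \<in> test_functions (U - {0})" for \<phi> :: "real^2 \<Rightarrow> real"
        using that by (auto simp: test_functions_def)
      show ?thesis
        unfolding distribution_on_def
      proof (intro conjI ballI allI impI)
        fix K assume K: "compact K \<and> K \<subseteq> U - {0}"
        then have "compact K \<and> K \<subseteq> U" by blast
        with E(1)[unfolded distribution_on_def, THEN conjunct2, THEN conjunct2, rule_format, of K]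
        obtain C N where "\<forall>\<phi>\<in>test_functions U. tsupp \<phi> \<subseteq> K \<longrightarrow>
          norm (E \<phi>) \<le> C * (\<Sum>\<alpha>\<in>{\<alpha>. mlen \<alpha> \<le> N}. SUP x. \<bar>mpartial \<alpha> \<phi> x\<bar>)" by auto
        then show "\<exists>C N. \<forall>\<phi>\<in>test_functions (U - {0}). tsupp \<phi> \<subseteq> K \<longrightarrow>
          norm (E \<phi>) \<le> C * (\<Sum>\<alpha>\<in>{\<alpha>. mlen \<alpha> \<le> N}. SUP x. \<bar>mpartial \<alpha> \<phi> x\<bar>)"
          by (intro exI[of _ C] exI[of _ N]) (simp add: sub)
      qed (use distribution_on_add[OF E(1)] distribution_on_cmult[OF E(1)] sub in simp_all)
    qed
    fix x assume x: "x \<in> U - {0}"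
    then have "x \<in> U" "x \<notin> sing_supp U E" using E(2) by auto
    then obtain V f where V: "open V" "x \<in> V" "V \<subseteq> U" "represents_on V f E"
      unfolding sing_supp_def by blast
    have "represents_on (V - {0}) f E"
      using V(4) unfolding represents_on_def
      by (auto intro: smooth_on_subset simp: test_functions_def)
    then show "\<exists>V f. open V \<and> x \<in> V \<and> V \<subseteq> U - {0} \<and> represents_on V f E"
      using V x by (intro exI[of _ "V - {0}"] exI[of _ f]) (auto intro: open_delete)
  qed
  then show ?thesis unfolding smooth_density_def by (rule someI_ex)
qed

lemma represents_on_component:
  fixes T :: "(real^2^2) distr"
  assumes "represents_on U f T" and \<phi>: "\<phi> \<in> test_functions U"
  shows "T \<phi> $ i $ j = (LINT x|lborel. \<phi> x * f x $ i $ j)"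
proof -
  have f: "smooth_on U f" and T: "T \<phi> = (LINT x|lborel. \<phi> x *\<^sub>R f x)"
    using assms unfolding represents_on_def by blast+
  have bl: "bounded_linear (\<lambda>M::real^2^2. M $ i $ j)"
    by (rule bounded_linear_compose[OF bounded_linear_vec_nth bounded_linear_vec_nth])
  have "(LINT x|lborel. (\<phi> x *\<^sub>R f x) $ i $ j) = (LINT x|lborel. \<phi> x *\<^sub>R f x) $ i $ j"
    by (rule integral_bounded_linear[OF bl test_function_integrable[OF \<phi> smooth_on_continuous[OF f]]])
  then show ?thesis by (simp add: T)
qed

lemma Curl_Curl_density:
  assumes U: "open U" and rep: "represents_on U f E"
  shows "continuous_on U (curl_vec (curl_ten f))"
    and "\<phi> \<in> test_functions U \<Longrightarrow>
      Curl_vec (Curl_ten E) \<phi> = (LINT x|lborel. \<phi> x * curl_vec (curl_ten f) x)"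
proof -
  have sf: "smooth_on U f" using rep by (simp add: represents_on_def)
  define F where "F i j x = f x $ i $ j" for i j x
  have F: "smooth_on U (F i j)" for i j
    unfolding F_def
    by (rule smooth_on_bounded_linear[OF bounded_linear_compose[OF bounded_linear_vec_nth bounded_linear_vec_nth] U sf])
  have FF: "smooth_on U (partial a (partial b (F i j)))" for a b i j
    by (intro smooth_on_partial F)
  have dF: "partial a (F i j) differentiable (at x)" if "x \<in> U" for a i j x
    using smooth_on_differentiable[OF smooth_on_partial[OF F] that] .
  have pd: "partial a (\<lambda>y. g y - h y) x = partial a g x - partial a h x"
    if "g differentiable (at x)" "h differentiable (at x)" for a x and g h :: "real^2 \<Rightarrow> real"
    using partial_add[OF that(1) differentiable_minus[OF that(2)], of a]
      partial_bounded_linear[OF bounded_linear_minus[OF bounded_linear_ident] that(2), of a] by simp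
  let ?G = "\<lambda>x. partial 1 (partial 1 (F 2 2)) x - partial 1 (partial 2 (F 2 1)) x
      - partial 2 (partial 1 (F 1 2)) x + partial 2 (partial 2 (F 1 1)) x"
  have G: "curl_vec (curl_ten f) x = ?G x" if "x \<in> U" for x
    using that by (simp add: curl_vec_def curl_ten_def F_def[symmetric, abs_def] pd dF)
  have cont: "continuous_on U (partial a (partial b (F i j)))" for a b i j
    by (rule smooth_on_continuous[OF FF])
  have "continuous_on U ?G" by (intro continuous_intros cont)
  then show "continuous_on U (curl_vec (curl_ten f))"
    by (rule continuous_on_eq) (simp add: G)
  assume \<phi>: "\<phi> \<in> test_functions U"
  have byparts: "E (partial a (partial b \<phi>)) $ i $ j = (LINT x|lborel. \<phi> x * partial b (partial a (F i j)) x)" for a b i j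
  proof -
    have "E (partial a (partial b \<phi>)) $ i $ j = (LINT x|lborel. partial a (partial b \<phi>) x * F i j x)"
      unfolding F_def by (rule represents_on_component[OF rep]) (intro test_functions_partial \<phi>)
    also have "\<dots> = - (LINT x|lborel. partial b \<phi> x * partial a (F i j) x)"
      by (rule integration_by_parts[OF U _ F]) (intro test_functions_partial \<phi>)
    also have "\<dots> = (LINT x|lborel. \<phi> x * partial b (partial a (F i j)) x)"
      by (simp add: integration_by_parts[OF U \<phi> smooth_on_partial[OF F]])
    finally show ?thesis .
  qed
  have int: "integrable lborel (\<lambda>x. \<phi> x * partial b (partial a (F i j)) x)" for a b i j
    using test_function_integrable[OF \<phi> cont, of b a i j] by simp
  have "Curl_vec (Curl_ten E) \<phi> = (LINT x|lborel. \<phi> x * ?G x)"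
    unfolding Curl_vec_Curl_ten byparts by (simp add: algebra_simps int)
  also have "(\<lambda>x. \<phi> x * ?G x) = (\<lambda>x. \<phi> x * curl_vec (curl_ten f) x)"
  proof
    fix x show "\<phi> x * ?G x = \<phi> x * curl_vec (curl_ten f) x"
    proof (cases "x \<in> U")
      case False
      then have "\<phi> x = 0" using test_functionsD(3)[OF \<phi>] not_in_tsupp by blast
      then show ?thesis by simp
    qed (simp add: G)
  qed
  finally show "Curl_vec (Curl_ten E) \<phi> = (LINT x|lborel. \<phi> x * curl_vec (curl_ten f) x)" .
qed

lemma Curl_Curl_vanishes_off_origin_iff:
  assumes U: "open U" and rep: "represents_on U f E"
  shows "(\<forall>\<phi>\<in>test_functions U. Curl_vec (Curl_ten E) \<phi> = 0) \<longleftrightarrow> (\<forall>x\<in>U. curl_vec (curl_ten f) x = 0)"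
proof
  assume *: "\<forall>\<phi>\<in>test_functions U. Curl_vec (Curl_ten E) \<phi> = 0"
  show "\<forall>x\<in>U. curl_vec (curl_ten f) x = 0"
  proof
    fix x assume x: "x \<in> U"
    show "curl_vec (curl_ten f) x = 0"
      by (rule fundamental_lemma_real[OF U Curl_Curl_density(1)[OF U rep] _ x])
         (simp add: Curl_Curl_density(2)[OF U rep, symmetric] *)
  qed
next
  assume *: "\<forall>x\<in>U. curl_vec (curl_ten f) x = 0"
  show "\<forall>\<phi>\<in>test_functions U. Curl_vec (Curl_ten E) \<phi> = 0"
  proof
    fix \<phi> :: "real^2 \<Rightarrow> real" assume \<phi>: "\<phi> \<in> test_functions U"
    have "\<phi> x * curl_vec (curl_ten f) x = 0" for x
      using * not_in_tsupp[of x \<phi>] test_functionsD(3)[OF \<phi>] by (cases "x \<in> U") auto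
    then have "(\<lambda>x. \<phi> x * curl_vec (curl_ten f) x) = (\<lambda>x. 0)" by (rule ext)
    then show "Curl_vec (Curl_ten E) \<phi> = 0" by (simp only: Curl_Curl_density(2)[OF U rep \<phi>]) simp
  qed
qed


section \<open>Scaling and the characterisation of compatibility\<close>

lemma test_functions_A_hessian:
  assumes "\<psi> \<in> test_functions U"
  shows "(\<lambda>x. A_map (hessian \<psi> x)) \<in> test_functions U"
proof (rule test_functionsI[of _ "tsupp \<psi>"])
  have "smooth_on UNIV (\<lambda>x. \<Sum>i\<in>UNIV. \<Sum>j\<in>UNIV. partial i (partial j \<psi>) x *\<^sub>R
      tensor (e3_cross (axis i 1)) (e3_cross (axis j 1)))"
    by (intro smooth_on_sum smooth_on_bilinear[OF bounded_bilinear_scaleR] smooth_on_const smooth_on_partial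
        test_functionsD(1)[OF assms] open_UNIV)
  then show "smooth_on UNIV (\<lambda>x. A_map (hessian \<psi> x))" by (simp add: A_map_def hessian_def)
  fix x assume "x \<notin> tsupp \<psi>"
  then have "partial i (partial j \<psi>) x = 0" for i j
    using tsupp_partial[of j \<psi>] by (intro partial_zero_off_tsupp) blast
  then show "A_map (hessian \<psi> x) = 0" by (simp add: A_map_def hessian_def)
qed (use test_functionsD[OF assms] in auto)

text \<open>
  The factor \<open>1/t\<^sup>2\<close> by which two-dimensional test functions are rescaled is exactly the one that the
  chain rule produces for second derivatives, so that the dilation on the right has no prefactor.
\<close>

lemma dilate_A_hessian:
  assumes "smooth_on UNIV \<psi>"
  shows "dilate t (\<lambda>x. A_map (hessian \<psi> x)) = (\<lambda>x. A_map (hessian (\<lambda>y. \<psi> ((1 / t) *\<^sub>R y)) x))"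
proof
  fix x
  have "hessian (\<lambda>y. \<psi> ((1 / t) *\<^sub>R y)) x = (1 / t^2) *\<^sub>R hessian \<psi> ((1 / t) *\<^sub>R x)"
    using word_partial_affine[OF assms, of "[i, j]" 0 "1/t" for i j]
    by (simp add: hessian_def vec_eq_iff word_partial_Cons power2_eq_square)
  then show "dilate t (\<lambda>x. A_map (hessian \<psi> x)) x = A_map (hessian (\<lambda>y. \<psi> ((1 / t) *\<^sub>R y)) x)"
    by (simp add: dilate_def linear_scale[OF linear_A_map])
qed

text \<open>
  Cutting \<open>w\<close> off inside the ball keeps its jet at 0.  The function dilated by \<open>t\<close> has the jet of
  \<open>(1/t)^d * w\<close>, because only derivatives of order \<open>d\<close> survive, and \<open>Curl Curl E\<close> depends on the jet only.
  So the decay of \<open>t\<^sup>k\<close> times the rescalings of \<open>E\<close> contradicts \<open>k < d\<close> unless the value at \<open>w\<close> is 0.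
\<close>

lemma scaling_annihilates_high_order:
  fixes w :: "real^2 \<Rightarrow> real"
  assumes U: "open U" and E: "E \<in> sing_sym_fields U" and r: "r > 0" "ball 0 r \<subseteq> U"
    and w: "w \<in> test_functions U"
    and hom: "\<And>is. length is \<noteq> d \<Longrightarrow> word_partial is w 0 = 0"
    and jet: "\<And>\<phi>. \<phi> \<in> test_functions U \<Longrightarrow> (\<And>is. word_partial is \<phi> 0 = 0) \<Longrightarrow> Curl_vec (Curl_ten E) \<phi> = 0"
    and k: "k < real d"
    and lim: "\<And>\<Phi>. \<Phi> \<in> test_functions (ball 0 r) \<Longrightarrow>
       ((\<lambda>t. t powr k * tensor_action E (dilate t \<Phi>)) \<longlongrightarrow> 0) (at_right 0)"
  shows "Curl_vec (Curl_ten E) w = 0"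
proof -
  let ?S = "Curl_vec (Curl_ten E)"
  note dE = sing_sym_fieldsD(1)[OF E]
  obtain \<eta> :: "real^2 \<Rightarrow> real" where \<eta>: "smooth_on UNIV \<eta>"
      "\<And>x. x \<in> cball 0 (r/2/2) \<Longrightarrow> \<eta> x = 1" "\<And>x. x \<notin> cball 0 (r/2) \<Longrightarrow> \<eta> x = 0"
    by (rule bump_at[of "r/2" 0]) (use r(1) in simp, rule that, assumption+)
  define \<psi> where "\<psi> x = w x * \<eta> x" for x
  have \<psi>U: "\<psi> \<in> test_functions U"
    unfolding \<psi>_def by (rule test_functions_mult(1)[OF U w]) (rule smooth_on_subset[OF \<eta>(1)], simp)
  note sm = test_functionsD(1)[OF \<psi>U]
  have \<psi>0: "\<psi> x = 0" if "x \<notin> cball 0 (r/2)" for x using \<eta>(3)[OF that] by (simp add: \<psi>_def)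
  have \<psi>: "\<psi> \<in> test_functions (ball 0 r)"
    by (rule test_functionsI[OF sm, of "cball 0 (r/2)"]) (use \<psi>0 r(1) in auto)
  have \<psi>w: "word_partial is \<psi> 0 = word_partial is w 0" for "is"
    by (rule word_partial_cong_open[of "ball 0 (r/2/2)"]) (use \<eta>(2) r(1) in \<open>auto simp: \<psi>_def\<close>)
  have scaled: "tensor_action E (dilate t (\<lambda>x. A_map (hessian \<psi> x))) = (1/t) ^ d * ?S w"
    if t: "0 < t" "t < 1" for t
  proof -
    define \<psi>\<^sub>t where "\<psi>\<^sub>t x = \<psi> ((1/t) *\<^sub>R x)" for x
    have sm_t: "smooth_on UNIV \<psi>\<^sub>t"
      using smooth_affine[OF sm, of 0 "1/t"] by (simp add: \<psi>\<^sub>t_def[abs_def])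
    have "\<psi>\<^sub>t x = 0" if x: "x \<notin> cball 0 (r/2)" for x
      unfolding \<psi>\<^sub>t_def
    proof (rule \<psi>0)
      have "r / 2 < norm x" using x by simp
      also have "\<dots> \<le> norm x / t" using t by (simp add: field_simps mult_left_le_one_le)
      finally show "(1/t) *\<^sub>R x \<notin> cball 0 (r/2)" using t by simp
    qed
    then have \<psi>\<^sub>t: "\<psi>\<^sub>t \<in> test_functions U"
      by (intro test_functionsI[OF sm_t, of "cball 0 (r/2)"]) (use r in auto)
    have cw: "(\<lambda>x. (- ((1/t) ^ d)) * w x) \<in> test_functions U" by (rule test_functions_cmult[OF w])
    have "?S (\<lambda>x. \<psi>\<^sub>t x + (- ((1/t) ^ d)) * w x) = 0"
    proof (rule jet[OF test_functions_add[OF \<psi>\<^sub>t cw]])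
      fix "is" :: "2 list"
      have "word_partial is \<psi>\<^sub>t 0 = (1/t) ^ length is * word_partial is w 0"
        using word_partial_affine[OF sm, of "is" 0 "1/t"] by (simp add: \<psi>\<^sub>t_def[abs_def] \<psi>w)
      moreover have "word_partial is (\<lambda>x. \<psi>\<^sub>t x + (- ((1/t) ^ d)) * w x) 0 =
          word_partial is \<psi>\<^sub>t 0 + (- ((1/t) ^ d)) * word_partial is w 0"
        by (simp only: word_partial_add[OF sm_t test_functionsD(1)[OF cw]] word_partial_cmult[OF test_functionsD(1)[OF w]])
      ultimately show "word_partial is (\<lambda>x. \<psi>\<^sub>t x + (- ((1/t) ^ d)) * w x) 0 = 0"
        using hom[of "is"] by (cases "length is = d") simp_all
    qed
    then have "?S \<psi>\<^sub>t = (1/t) ^ d * ?S w"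
      by (simp only: Curl_Curl_add[OF dE \<psi>\<^sub>t cw] Curl_Curl_cmult[OF dE w])
    moreover have "tensor_action E (dilate t (\<lambda>x. A_map (hessian \<psi> x))) = ?S \<psi>\<^sub>t"
      unfolding dilate_A_hessian[OF sm] Curl_Curl_eq_tensor_action[OF E \<psi>\<^sub>t] by (simp add: \<psi>\<^sub>t_def[abs_def])
    ultimately show ?thesis by simp
  qed
  have "((\<lambda>t. \<bar>t powr k * tensor_action E (dilate t (\<lambda>x. A_map (hessian \<psi> x)))\<bar>) \<longlongrightarrow> \<bar>0\<bar>) (at_right 0)"
    by (intro tendsto_rabs lim test_functions_A_hessian[OF \<psi>])
  moreover have "\<forall>\<^sub>F t in at_right 0. \<bar>?S w\<bar> \<le> \<bar>t powr k * tensor_action E (dilate t (\<lambda>x. A_map (hessian \<psi> x)))\<bar>"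
  proof (rule eventually_at_rightI[of 0 1])
    fix t :: real assume "t \<in> {0<..<1}"
    then have t: "0 < t" "t < 1" by auto
    have "t powr k * (1/t) ^ d = t powr (k - real d)"
      using t by (simp add: powr_diff powr_realpow power_one_over field_simps)
    also have "\<dots> \<ge> 1"
      using t k powr_mono'[of "k - real d" 0 t] by simp
    finally have "1 * \<bar>?S w\<bar> \<le> (t powr k * (1/t) ^ d) * \<bar>?S w\<bar>" by (intro mult_right_mono) simp_all
    then show "\<bar>?S w\<bar> \<le> \<bar>t powr k * tensor_action E (dilate t (\<lambda>x. A_map (hessian \<psi> x)))\<bar>"
      using t by (simp add: scaled abs_mult mult.assoc)
  qed simp
  ultimately have "\<bar>?S w\<bar> \<le> \<bar>0\<bar>"
    by (rule tendsto_lowerbound) simp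
  then show ?thesis by simp
qed

theorem lemma4p5:
  fixes \<Omega> :: "(real^2) set" and E :: "(real^2^2) distr"
    and w :: "multi_index \<Rightarrow> real^2 \<Rightarrow> real" and r :: real
  assumes "open \<Omega>" and "bounded \<Omega>" and "simply_connected \<Omega>" and "0 \<in> \<Omega>"
    and "E \<in> sing_sym_fields \<Omega>"
    and "r > 0" and "ball 0 r \<subseteq> \<Omega>"
    and "\<And>\<alpha>. w \<alpha> \<in> test_functions \<Omega>"
    and "\<And>\<alpha> \<beta>. mpartial \<beta> (w \<alpha>) 0 = (if \<beta> = \<alpha> then (- 1) ^ mlen \<alpha> else 0)"
  shows "(\<forall>\<phi>\<in>test_functions \<Omega>. Curl_vec (Curl_ten E) \<phi> = 0) \<longleftrightarrow>
      (\<forall>x\<in>\<Omega> - {0}. curl_vec (curl_ten (smooth_density (\<Omega> - {0}) E)) x = 0) \<and>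
      (\<forall>\<alpha>. ereal (real (mlen \<alpha>)) \<le> divergence_degree r E + 2 \<longrightarrow>
           tensor_action E (\<lambda>x. A_map (hessian (w \<alpha>) x)) = 0)"
proof -
  let ?S = "Curl_vec (Curl_ten E)"
  note E = sing_sym_fieldsD[OF assms(5)]
  note w = assms(8) and w0 = assms(9)
  have Sw: "tensor_action E (\<lambda>x. A_map (hessian (w \<alpha>) x)) = ?S (w \<alpha>)" for \<alpha>
    using Curl_Curl_eq_tensor_action[OF assms(5) w] by simp
  have off: "(\<forall>\<phi>\<in>test_functions (\<Omega> - {0}). ?S \<phi> = 0) \<longleftrightarrow>
      (\<forall>x\<in>\<Omega> - {0}. curl_vec (curl_ten (smooth_density (\<Omega> - {0}) E)) x = 0)"
    by (rule Curl_Curl_vanishes_off_origin_iff[OF _ smooth_density_represents[OF assms(1) E(1,3)]])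
       (use assms(1) in \<open>auto intro: open_delete\<close>)
  show ?thesis
  proof (intro iffI conjI allI impI; (elim conjE)?)
    assume S0: "\<forall>\<phi>\<in>test_functions \<Omega>. ?S \<phi> = 0"
    then have "\<forall>\<phi>\<in>test_functions (\<Omega> - {0}). ?S \<phi> = 0" by (auto simp: test_functions_def)
    then show "\<forall>x\<in>\<Omega> - {0}. curl_vec (curl_ten (smooth_density (\<Omega> - {0}) E)) x = 0" unfolding off .
    show "tensor_action E (\<lambda>x. A_map (hessian (w \<alpha>) x)) = 0" for \<alpha> using S0 w Sw by simp
  next
    assume i: "\<forall>x\<in>\<Omega> - {0}. curl_vec (curl_ten (smooth_density (\<Omega> - {0}) E)) x = 0"
      and ii: "\<forall>\<alpha>. ereal (real (mlen \<alpha>)) \<le> divergence_degree r E + 2 \<longrightarrow>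
           tensor_action E (\<lambda>x. A_map (hessian (w \<alpha>) x)) = 0"
    have supp: "?S \<phi> = 0" if "\<phi> \<in> test_functions (\<Omega> - {0})" for \<phi> using i that off by blast
    obtain s where s: "s > 0" "cball 0 s \<subseteq> \<Omega>" using assms(1,4) open_contains_cball by blast
    obtain C N where bound: "\<forall>\<phi>\<in>test_functions \<Omega>. \<forall>M. tsupp \<phi> \<subseteq> cball 0 s \<longrightarrow>
        (\<forall>is x. length is \<le> N \<longrightarrow> \<bar>word_partial is \<phi> x\<bar> \<le> M) \<longrightarrow> \<bar>?S \<phi>\<bar> \<le> C * M"
      by (rule Curl_Curl_word_partial_bound[OF E(1) compact_cball s(2)]) (rule that)
    have jet: "?S \<phi> = 0" if "\<phi> \<in> test_functions \<Omega>" "\<And>is. length is \<le> N \<Longrightarrow> word_partial is \<phi> 0 = 0" for \<phi>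
      by (rule point_supported_vanishes[OF assms(1) s Curl_Curl_add[OF E(1)] supp bound[rule_format] that])
    have w_zero: "?S (w \<alpha>) = 0" for \<alpha>
    proof (cases "ereal (real (mlen \<alpha>)) \<le> divergence_degree r E + 2")
      case True
      then show ?thesis using ii Sw[of \<alpha>] by metis
    next
      case False
      moreover have "divergence_degree r E + 2 = scaling_degree r E"
        unfolding divergence_degree_def by (cases "scaling_degree r E") (simp_all add: numeral_eq_ereal)
      ultimately have "scaling_degree r E < ereal (real (mlen \<alpha>))" by simp
      then obtain k where k: "k < real (mlen \<alpha>)" and lim: "\<forall>\<Phi>\<in>test_functions (ball 0 r).
          ((\<lambda>t. t powr k * tensor_action E (dilate t \<Phi>)) \<longlongrightarrow> 0) (at_right 0)"
        unfolding scaling_degree_def INF_less_iff by auto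
      show ?thesis
      proof (rule scaling_annihilates_high_order[OF assms(1,5,6,7) w _ _ k])
        fix "is" :: "2 list" assume "length is \<noteq> mlen \<alpha>"
        then show "word_partial is (w \<alpha>) 0 = 0"
          using word_partial_eq_mpartial[of "is"] test_functionsD(1)[OF w[of \<alpha>]] w0[of _ \<alpha>] by auto
      qed (use jet lim in auto)
    qed
    show "\<forall>\<phi>\<in>test_functions \<Omega>. ?S \<phi> = 0"
    proof
      fix \<phi> :: "real^2 \<Rightarrow> real" assume \<phi>: "\<phi> \<in> test_functions \<Omega>"
      let ?A = "{\<alpha>. mlen \<alpha> \<le> N}"
      \<comment> \<open>The sign undoes the normalisation \<open>(-1)^\<bar>\<alpha>\<bar>\<close> of the derivatives of \<open>w \<alpha>\<close> at the origin, so that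
        adding \<open>\<Sum>\<alpha>. c \<alpha> * w \<alpha>\<close> cancels the jet of \<open>\<phi>\<close> up to order \<open>N\<close>.\<close>
      define c where "c \<alpha> = - ((- 1) ^ mlen \<alpha> * mpartial \<alpha> \<phi> 0)" for \<alpha>
      have fin: "finite ?A"
        by (rule finite_subset[of _ "{..N} \<times> {..N}"]) (auto simp: mlen_def)
      have cw: "(\<lambda>x. c \<alpha> * w \<alpha> x) \<in> test_functions \<Omega>" for \<alpha> by (rule test_functions_cmult[OF w])
      have sum_test: "(\<lambda>x. \<Sum>\<alpha>\<in>?A. c \<alpha> * w \<alpha> x) \<in> test_functions \<Omega>"
        by (intro test_functions_sum cw)
      have "?S (\<lambda>x. \<phi> x + (\<Sum>\<alpha>\<in>?A. c \<alpha> * w \<alpha> x)) = 0"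
      proof (rule jet[OF test_functions_add[OF \<phi> sum_test]])
        fix "is" :: "2 list" assume len: "length is \<le> N"
        obtain \<beta> where \<beta>: "mlen \<beta> = length is" "\<And>f. smooth_on UNIV f \<Longrightarrow> word_partial is f = mpartial \<beta> f"
          using word_partial_eq_mpartial by blast
        have "word_partial is (\<lambda>x. \<phi> x + (\<Sum>\<alpha>\<in>?A. c \<alpha> * w \<alpha> x)) 0 =
            word_partial is \<phi> 0 + (\<Sum>\<alpha>\<in>?A. c \<alpha> * word_partial is (w \<alpha>) 0)"
          by (simp only: word_partial_add[OF test_functionsD(1)[OF \<phi>] test_functionsD(1)[OF sum_test]]
              word_partial_sum[OF test_functionsD(1)[OF cw]] word_partial_cmult[OF test_functionsD(1)[OF w]])
        also have "\<dots> = mpartial \<beta> \<phi> 0 + (\<Sum>\<alpha>\<in>?A. c \<alpha> * mpartial \<beta> (w \<alpha>) 0)"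
          by (simp only: \<beta>(2)[OF test_functionsD(1)[OF \<phi>]] \<beta>(2)[OF test_functionsD(1)[OF w]])
        also have "(\<Sum>\<alpha>\<in>?A. c \<alpha> * mpartial \<beta> (w \<alpha>) 0) = (\<Sum>\<alpha>\<in>?A. if \<alpha> = \<beta> then c \<alpha> * (- 1) ^ mlen \<alpha> else 0)"
          by (intro sum.cong) (auto simp: w0)
        also have "\<dots> = c \<beta> * (- 1) ^ mlen \<beta>" using fin \<beta>(1) len by simp
        also have "\<dots> = - mpartial \<beta> \<phi> 0" by (simp add: c_def power_mult_distrib[symmetric])
        finally show "word_partial is (\<lambda>x. \<phi> x + (\<Sum>\<alpha>\<in>?A. c \<alpha> * w \<alpha> x)) 0 = 0" by simp
      qed
      moreover have "?S (\<lambda>x. \<Sum>\<alpha>\<in>?A. c \<alpha> * w \<alpha> x) = 0"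
        by (simp only: Curl_Curl_sum[OF E(1) fin cw] Curl_Curl_cmult[OF E(1) w] w_zero) simp
      ultimately show "?S \<phi> = 0"
        by (simp only: Curl_Curl_add[OF E(1) \<phi> sum_test])
    qed
  qed
qed

end
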